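(* Let $q\in\mathbb{C}$ with $0<|q|<1$, let $\ell\ge 0$ be an integer, and let $z\in\mathbb{C}$ with $z\ne 0$ and $z\notin\{1,q^{-1},q^{-2},\dots\}$. Then $$(z;q)_{\infty}\,{}_{1}\phi_{1}\left(-q^{\ell+1}/z;z;q,-z\right)=\frac{(-1)^{\ell}q^{-\binom{\ell}{2}}}{(q,q^{4};q^{5})_{\infty}}\sum_{n=0}^{\infty}\frac{a_{2n+\ell}(q)}{(q^{2};q^{2})_{n}}\left(\frac{z}{q^{\ell}}\right)^{2n}-\frac{(-1)^{\ell}q^{-\binom{\ell}{2}}}{(q^{2},q^{3};q^{5})_{\infty}}\sum_{n=0}^{\infty}\frac{b_{2n+\ell}(q)}{(q^{2};q^{2})_{n}}\left(\frac{z}{q^{\ell}}\right)^{2n}.$$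
   Context: Notation: for a base $p$ with $|p|<1$, $(a;p)_\infty=\prod_{k\ge0}(1-ap^k)$, $(a;p)_n=\prod_{k=0}^{n-1}(1-ap^k)$, and $(a_1,\dots,a_r;p)_n=\prod_i (a_i;p)_n$ (also for $n=\infty$). ${}_1\phi_1(a;c;q,x)=\sum_{n=0}^\infty\frac{(a;q)_n}{(q;q)_n(c;q)_n}(-1)^nq^{n(n-1)/2}x^n$. The Gaussian binomial is $\begin{bmatrix} n\\ k\end{bmatrix}_q=\frac{(q;q)_n}{(q;q)_k(q;q)_{n-k}}$ for integers $0\le k\le n$ and $0$ otherwise. The Schur polynomials are $$a_m(q)=\sum_{j\ge 0} q^{j^2+j}\begin{bmatrix} m-j-2 \\ j\end{bmatrix}_q\ (m\ge 1),\qquad b_m(q)=\sum_{j\ge 0} q^{j^2}\begin{bmatrix} m-j-1 \\ j\end{bmatrix}_q\ (m\ge 0),$$ together with $a_0(q)=1$; thus $a_0=1,\ a_1=0,\ b_0=0,\ b_1=1$.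
   Formalization: The two series on the right converge separately only for |z|<|q|^ℓ; there the formula is proved as printed. For every other admissible z the right-hand side is read as the limit of the difference of the N-th partial sums with the given prefactors. *)

theory Defs
  imports "HOL-Analysis.Analysis"
begin

definition qpoch :: "complex \<Rightarrow> complex \<Rightarrow> nat \<Rightarrow> complex" where
  "qpoch a p n = (\<Prod>k<n. 1 - a * p ^ k)"

definition qpoch_inf :: "complex \<Rightarrow> complex \<Rightarrow> complex" where
  "qpoch_inf a p = (\<Prod>k. 1 - a * p ^ k)"

definition phi11 :: "complex \<Rightarrow> complex \<Rightarrow> complex \<Rightarrow> complex \<Rightarrow> complex" where
  "phi11 a c q x =
     (\<Sum>n. qpoch a q n / (qpoch q q n * qpoch c q n) * (-1) ^ n * q ^ (n * (n - 1) div 2) * x ^ n)"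

text \<open>The arguments are integers because the Schur polynomials below use negative upper entries,
  for which the Gaussian binomial is 0 (truncated subtraction on the naturals would give wrong
  values, e.g. for \<open>schur_a 1\<close> and \<open>schur_b 0\<close>).\<close>

definition qbinom :: "complex \<Rightarrow> int \<Rightarrow> int \<Rightarrow> complex" where
  "qbinom q n k =
     (if 0 \<le> k \<and> k \<le> n
      then qpoch q q (nat n) / (qpoch q q (nat k) * qpoch q q (nat (n - k)))
      else 0)"

text \<open>In both series only finitely many terms are nonzero.\<close>

definition schur_a :: "nat \<Rightarrow> complex \<Rightarrow> complex" where
  "schur_a m q =
     (if m = 0 then 1
      else (\<Sum>j. q ^ (j\<^sup>2 + j) * qbinom q (int m - int j - 2) (int j)))"

definition schur_b :: "nat \<Rightarrow> complex \<Rightarrow> complex" where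
  "schur_b m q = (\<Sum>j. q ^ (j\<^sup>2) * qbinom q (int m - int j - 1) (int j))"

text \<open>The two series on the right-hand side of the transformation formula.  As \<open>m\<close> grows,
  \<open>schur_a m q\<close> and \<open>schur_b m q\<close> tend to nonzero limits, so each series on its own
  converges only for \<open>norm z < norm q ^ l\<close>; the difference of the two, with
  the prefactors of the formula, converges for every \<open>z\<close> when taken termwise.\<close>

definition a_term :: "complex \<Rightarrow> nat \<Rightarrow> complex \<Rightarrow> nat \<Rightarrow> complex" where
  "a_term q l z n = schur_a (2 * n + l) q / qpoch (q\<^sup>2) (q\<^sup>2) n * (z / q ^ l) ^ (2 * n)"

definition b_term :: "complex \<Rightarrow> nat \<Rightarrow> complex \<Rightarrow> nat \<Rightarrow> complex" where
  "b_term q l z n = schur_b (2 * n + l) q / qpoch (q\<^sup>2) (q\<^sup>2) n * (z / q ^ l) ^ (2 * n)"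

end

theory Submission
  imports Defs
begin

text \<open>
Write \<open>(a;q)\<close> for the infinite product.  Multiplying the series \<open>\<^sub>1\<phi>\<^sub>1\<close> by \<open>(z;q)\<close> replaces each denominator \<open>(z;q)\<^sub>n\<close>
by a factor \<open>(z q^n;q)\<close>.  Expanding this factor by Euler and the numerator \<open>(-q^(l+1)/z;q)\<^sub>n\<close> by the
\<open>q\<close>-binomial theorem gives an absolutely convergent triple series (\<open>triple_sum_by_k_plus_m\<close>).
Its exponents of \<open>q\<close> depend on two of the three indices only through their sum \<open>N\<close>.  Regrouping by \<open>N\<close>
(\<open>triple_sum_by_m_plus_j\<close>) produces an alternating sum of Gaussian binomials, which Gauss evaluated: it vanishes for odd
\<open>N\<close> and leaves \<open>1 / (q\<^sup>2;q\<^sup>2)\<^sub>n\<close> for \<open>N = 2n\<close>.  The third index contributes the shifted Rogers-Ramanujan sum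
\<open>S\<^sub>m = \<Sum>\<^sub>k q^(k\<^sup>2 + m k) / (q;q)\<^sub>k\<close> with \<open>m = 2n + l\<close>.  Thus the left side equals
\<open>\<Sum>\<^sub>n q^(2n choose 2) z^(2n) S\<^sub>2\<^sub>n\<^sub>+\<^sub>l / (q\<^sup>2;q\<^sup>2)\<^sub>n\<close>.

It remains to express \<open>S\<^sub>m\<close> by Schur's polynomials (\<open>rr_sum_schur\<close>).  The sequence \<open>(-1)^m q^(m choose 2) S\<^sub>m\<close>
satisfies the recursion of \<open>a\<^sub>m\<close> and \<open>b\<^sub>m\<close>, so the claim reduces to the values of \<open>S\<^sub>0\<close> and \<open>S\<^sub>1\<close>,
that is, to the two Rogers-Ramanujan identities (\<open>rogers_ramanujan\<close>).  These are proved by the method of Rogers and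
Ramanujan: an explicit family of theta-like series \<open>V\<^sub>m\<close> satisfies, by telescoping, the recursion
\<open>V\<^sub>m = V\<^sub>m\<^sub>+\<^sub>1 + q^(m+1) V\<^sub>m\<^sub>+\<^sub>2\<close> of \<open>S\<^sub>m\<close>.  A solution of this recursion is determined by its limit
(\<open>backward_recursion_unique\<close>), hence \<open>V\<^sub>m = (q;q) S\<^sub>m\<close>.  The required initial series are genuine theta series, and
Jacobi's triple product turns them into the products modulo \<open>5\<close>.
\<close>

section \<open>Termwise limits and theta-type series\<close>

text \<open>Dominated convergence for counting measure: a limit may be taken termwise in a series with a
summable majorant.  Finite \<open>q\<close>-series identities are passed to the limit with it.\<close>
lemma tannery:
  fixes f :: "nat \<Rightarrow> nat \<Rightarrow> complex"
  assumes lim: "\<And>k. (\<lambda>n. f n k) \<longlonglongrightarrow> g k"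
    and bound: "\<And>n k. norm (f n k) \<le> M k"
    and M: "summable M"
  shows "(\<lambda>n. \<Sum>k. f n k) \<longlonglongrightarrow> (\<Sum>k. g k)"
proof -
  let ?C = "count_space (UNIV :: nat set)"
  have M0: "M k \<ge> 0" for k
    using bound[of 0 k] norm_ge_zero order_trans by blast
  have intM: "integrable ?C M"
    using M M0 by (simp add: integrable_count_space_nat_iff)
  have intf: "integrable ?C (f n)" for n
    by (rule Bochner_Integration.integrable_bound[OF intM]) (use bound M0 in auto)
  have gb: "norm (g k) \<le> M k" for k
    by (rule LIMSEQ_le_const2[OF tendsto_norm[OF lim]]) (use bound in auto)
  have intg: "integrable ?C g"
    by (rule Bochner_Integration.integrable_bound[OF intM]) (use gb M0 in auto)
  have "(\<lambda>n. integral\<^sup>L ?C (f n)) \<longlonglongrightarrow> integral\<^sup>L ?C g"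
    by (rule integral_dominated_convergence[where w = M]) (use lim bound intM in auto)
  then show ?thesis
    using intf intg by (simp add: integral_count_space_nat)
qed

lemma Suc_choose_two: "Suc n choose 2 = (n choose 2) + n"
  by (simp add: numeral_2_eq_2)

lemma zero_choose_two [simp]: "0 choose 2 = (0::nat)"
  by (simp add: binomial_eq_0)

lemma add_choose_two: "(m + n) choose 2 = (m choose 2) + (n choose 2) + m * n"
  by (induction n) (auto simp: Suc_choose_two)

text \<open>The quadratic exponent beats every geometric growth: consecutive terms have ratio
\<open>x * t ^ n\<close>, which tends to \<open>0\<close>.\<close>
lemma summable_theta:
  fixes t x :: real
  assumes t: "0 \<le> t" "t < 1" and x: "0 \<le> x"
  shows "summable (\<lambda>n. t ^ (n choose 2) * x ^ n)"
proof -
  have "(\<lambda>n. x * t ^ n) \<longlonglongrightarrow> x * 0"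
    by (intro tendsto_intros LIMSEQ_power_zero) (use t in auto)
  then have "eventually (\<lambda>n. x * t ^ n < 1 / 2) sequentially"
    using order_tendstoD(2)[of "\<lambda>n. x * t ^ n" "x * 0" sequentially "1 / 2"] by simp
  then obtain N where N: "\<And>n. n \<ge> N \<Longrightarrow> x * t ^ n < 1 / 2"
    by (auto simp: eventually_sequentially)
  show ?thesis
  proof (rule summable_ratio_test[of "1/2" N])
    fix n assume "n \<ge> N"
    have "norm (t ^ (Suc n choose 2) * x ^ Suc n)
        = (x * t ^ n) * norm (t ^ (n choose 2) * x ^ n)"
      using t x by (simp add: Suc_choose_two power_add)
    also have "\<dots> \<le> 1 / 2 * norm (t ^ (n choose 2) * x ^ n)"
      using N[OF \<open>n \<ge> N\<close>] by (intro mult_right_mono) auto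
    finally show "norm (t ^ (Suc n choose 2) * x ^ Suc n) \<le> 1 / 2 * norm (t ^ (n choose 2) * x ^ n)" .
  qed auto
qed

section \<open>q-shifted factorials\<close>

lemma qpoch_0 [simp]: "qpoch a p 0 = 1"
  by (simp add: qpoch_def)

lemma qpoch_Suc: "qpoch a p (Suc n) = qpoch a p n * (1 - a * p ^ n)"
  by (simp add: qpoch_def)

lemma qpoch_add: "qpoch a p (n + m) = qpoch a p n * qpoch (a * p ^ n) p m"
  by (induction m) (simp_all add: qpoch_Suc power_add mult.assoc)

lemma abs_convergent_prod_qpoch:
  fixes a p :: complex
  assumes "norm p < 1"
  shows "abs_convergent_prod (\<lambda>k. 1 - a * p ^ k)"
proof (rule summable_imp_abs_convergent_prod)
  have "summable (\<lambda>k. norm a * norm p ^ k)"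
    using assms by (intro summable_mult summable_geometric) auto
  then show "summable (\<lambda>k. norm (1 - a * p ^ k - 1))"
    by (simp add: norm_mult norm_power)
qed

lemma qpoch_tendsto:
  assumes "norm p < 1"
  shows "qpoch a p \<longlonglongrightarrow> qpoch_inf a p"
proof -
  have "convergent_prod (\<lambda>k. 1 - a * p ^ k)"
    using abs_convergent_prod_qpoch[OF assms] by (rule abs_convergent_prod_imp_convergent_prod)
  then have "(\<lambda>n. \<Prod>k\<le>n. 1 - a * p ^ k) \<longlonglongrightarrow> qpoch_inf a p"
    unfolding qpoch_inf_def by (rule convergent_prod_LIMSEQ)
  then have "(\<lambda>n. qpoch a p (Suc n)) \<longlonglongrightarrow> qpoch_inf a p"
    by (simp add: qpoch_def lessThan_Suc_atMost)
  then show ?thesis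
    by (rule LIMSEQ_imp_Suc)
qed

lemma qpoch_inf_nonzero:
  assumes "norm p < 1" and "\<And>k. a * p ^ k \<noteq> 1"
  shows "qpoch_inf a p \<noteq> 0"
  unfolding qpoch_inf_def
  by (rule prodinf_nonzero[OF abs_convergent_prod_imp_convergent_prod])
     (use assms abs_convergent_prod_qpoch in auto)

lemma qpoch_inf_split:
  assumes "norm p < 1"
  shows "qpoch_inf a p = qpoch a p n * qpoch_inf (a * p ^ n) p"
proof (rule LIMSEQ_unique)
  show "(\<lambda>m. qpoch a p (m + n)) \<longlonglongrightarrow> qpoch_inf a p"
    by (rule LIMSEQ_ignore_initial_segment[OF qpoch_tendsto[OF assms]])
  show "(\<lambda>m. qpoch a p (m + n)) \<longlonglongrightarrow> qpoch a p n * qpoch_inf (a * p ^ n) p"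
    unfolding add.commute[of _ n] qpoch_add
    by (intro tendsto_intros qpoch_tendsto assms)
qed

lemma power_ne_1_of_norm_less_1:
  fixes q :: complex
  assumes "norm q < 1" "n > 0"
  shows "q ^ n \<noteq> 1"
proof
  assume "q ^ n = 1"
  then have "norm q ^ n = 1"
    by (metis norm_one norm_power)
  then show False
    using assms power_less_one_iff[of "norm q" n] by simp
qed

lemma qpoch_inf_power_nonzero:
  assumes "norm q < 1" "i > 0" "j > 0"
  shows "qpoch_inf (q ^ i) (q ^ j) \<noteq> 0"
proof (rule qpoch_inf_nonzero)
  show "norm (q ^ j) < 1"
    using assms power_less_one_iff[of "norm q" j] by (simp add: norm_power)
  show "q ^ i * (q ^ j) ^ k \<noteq> 1" for k
    using power_ne_1_of_norm_less_1[of q "i + j * k"] assms by (simp add: power_add power_mult)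
qed

context
  fixes q :: complex
  assumes q: "norm q < 1"
begin

lemma one_minus_power_nonzero: "1 - q ^ Suc n \<noteq> 0"
  using power_ne_1_of_norm_less_1[OF q, of "Suc n"] by auto

lemma qpoch_qq_nonzero: "qpoch q q n \<noteq> 0"
  using one_minus_power_nonzero by (auto simp: qpoch_def)

lemma qpoch_inf_qq_nonzero: "qpoch_inf q q \<noteq> 0"
  using qpoch_inf_power_nonzero[OF q, of 1 1] by simp

lemma qpoch_qq_Suc: "qpoch q q (Suc n) = (1 - q ^ Suc n) * qpoch q q n"
  by (simp add: qpoch_Suc)

text \<open>Both \<open>(q;q)\<^sub>n\<close> and its reciprocal are bounded because \<open>(q;q)\<^sub>n\<close> converges to a nonzero limit.
This supplies the majorants in all later uses of dominated convergence.\<close>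
lemma qpoch_qq_bounded:
  "\<exists>B\<ge>1. \<forall>n. norm (qpoch q q n) \<le> B \<and> norm (1 / qpoch q q n) \<le> B"
proof -
  have "Bseq (qpoch q q)"
    using qpoch_tendsto[OF q] convergentI Bseq_eq_bounded convergent_imp_Bseq by blast
  then obtain B1 where B1: "\<And>n. norm (qpoch q q n) \<le> B1"
    by (meson BseqE)
  have "(\<lambda>n. 1 / qpoch q q n) \<longlonglongrightarrow> 1 / qpoch_inf q q"
    by (intro tendsto_intros qpoch_tendsto q qpoch_inf_qq_nonzero)
  then have "Bseq (\<lambda>n. 1 / qpoch q q n)"
    using convergentI convergent_imp_Bseq by blast
  then obtain B2 where B2: "\<And>n. norm (1 / qpoch q q n) \<le> B2"
    by (meson BseqE)
  have "norm (qpoch q q n) \<le> max 1 (max B1 B2) \<and> norm (1 / qpoch q q n) \<le> max 1 (max B1 B2)" for n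
    using B1[of n] B2[of n] by linarith
  then show ?thesis
    by (intro exI[of _ "max 1 (max B1 B2)"] conjI allI) simp_all
qed

section \<open>Finite q-binomial sums\<close>

text \<open>The Gaussian binomials divided by \<open>(q;q)\<^sub>n\<close> turn finite \<open>q\<close>-binomial sums into convolutions.
Splitting \<open>1 - q^(n+1)\<close> as \<open>(1 - q^(n+1-k)) + q^(n+1-k) (1 - q^k)\<close> cancels one factor in either
denominator; this is the \<open>q\<close>-Pascal rule, summed against an arbitrary sequence \<open>u\<close>.\<close>
lemma q_pascal_convolution:
  "(1 - q ^ Suc n) * (\<Sum>k\<le>Suc n. u k / (qpoch q q k * qpoch q q (Suc n - k)))
     = (\<Sum>k\<le>n. (u k + q ^ (n - k) * u (Suc k)) / (qpoch q q k * qpoch q q (n - k)))"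
proof -
  let ?P = "qpoch q q"
  have split: "(1 - q ^ Suc n) * (u k / (?P k * ?P (Suc n - k)))
      = (1 - q ^ (Suc n - k)) * (u k / (?P k * ?P (Suc n - k)))
        + q ^ (Suc n - k) * (1 - q ^ k) * (u k / (?P k * ?P (Suc n - k)))" if "k \<le> Suc n" for k
  proof -
    have "q ^ Suc n = q ^ (Suc n - k) * q ^ k"
      using that by (metis le_add_diff_inverse2 power_add)
    then have "1 - q ^ Suc n = (1 - q ^ (Suc n - k)) + q ^ (Suc n - k) * (1 - q ^ k)"
      by (simp add: algebra_simps)
    then show ?thesis by (simp only: distrib_right)
  qed
  \<comment> \<open>The summand \<open>k = n + 1\<close> vanishes here, and the summand \<open>k = 0\<close> in the second sum.\<close>
  have first: "(\<Sum>k\<le>Suc n. (1 - q ^ (Suc n - k)) * (u k / (?P k * ?P (Suc n - k))))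
      = (\<Sum>k\<le>n. u k / (?P k * ?P (n - k)))"
  proof -
    have "(1 - q ^ (Suc n - k)) * (u k / (?P k * ?P (Suc n - k))) = u k / (?P k * ?P (n - k))"
      if "k \<le> n" for k
      using that one_minus_power_nonzero[of "n - k"] qpoch_qq_nonzero
      by (simp add: Suc_diff_le qpoch_qq_Suc del: power_Suc)
    then show ?thesis by (simp del: power_Suc)
  qed
  have second: "(\<Sum>k\<le>Suc n. q ^ (Suc n - k) * (1 - q ^ k) * (u k / (?P k * ?P (Suc n - k))))
      = (\<Sum>k\<le>n. q ^ (n - k) * u (Suc k) / (?P k * ?P (n - k)))"
  proof -
    have "q ^ (n - k) * (1 - q ^ Suc k) * (u (Suc k) / (?P (Suc k) * ?P (n - k)))
        = q ^ (n - k) * u (Suc k) / (?P k * ?P (n - k))" for k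
      using one_minus_power_nonzero[of k] qpoch_qq_nonzero
      by (simp add: qpoch_qq_Suc field_simps del: power_Suc)
    then show ?thesis by (subst sum.atMost_Suc_shift) (simp del: power_Suc)
  qed
  have "(1 - q ^ Suc n) * (\<Sum>k\<le>Suc n. u k / (?P k * ?P (Suc n - k)))
      = (\<Sum>k\<le>Suc n. (1 - q ^ (Suc n - k)) * (u k / (?P k * ?P (Suc n - k))))
        + (\<Sum>k\<le>Suc n. q ^ (Suc n - k) * (1 - q ^ k) * (u k / (?P k * ?P (Suc n - k))))"
    unfolding sum_distrib_left sum.distrib[symmetric]
    by (intro sum.cong refl split) simp
  also have "\<dots> = (\<Sum>k\<le>n. (u k + q ^ (n - k) * u (Suc k)) / (?P k * ?P (n - k)))"
    unfolding first second sum.distrib[symmetric] by (simp add: add_divide_distrib)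
  finally show ?thesis .
qed

text \<open>For \<open>u k = (-1)^k q^(k choose 2) a^k\<close> the \<open>q\<close>-Pascal convolution reproduces \<open>u\<close> itself up to the factor
\<open>1 - a q^n\<close>, which is the next factor of \<open>(a;q)\<close>.\<close>
lemma q_binomial_theorem:
  "(\<Sum>k\<le>n. (-1) ^ k * q ^ (k choose 2) * a ^ k / (qpoch q q k * qpoch q q (n - k)))
     = qpoch a q n / qpoch q q n"
proof (induction n)
  case (Suc n)
  let ?u = "\<lambda>k. (-1) ^ k * q ^ (k choose 2) * a ^ k"
  have "?u k + q ^ (n - k) * ?u (Suc k) = (1 - a * q ^ n) * ?u k" if "k \<le> n" for k
  proof -
    have "q ^ n = q ^ (n - k) * q ^ k"
      using that by (metis le_add_diff_inverse2 power_add)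
    then show ?thesis by (simp add: Suc_choose_two power_add algebra_simps)
  qed
  then have "(1 - q ^ Suc n) * (\<Sum>k\<le>Suc n. ?u k / (qpoch q q k * qpoch q q (Suc n - k)))
      = (1 - a * q ^ n) * (\<Sum>k\<le>n. ?u k / (qpoch q q k * qpoch q q (n - k)))"
    by (subst q_pascal_convolution, subst sum_distrib_left, intro sum.cong refl)
       (simp only: atMost_iff times_divide_eq_right)
  then have "(1 - q ^ Suc n) * (\<Sum>k\<le>Suc n. ?u k / (qpoch q q k * qpoch q q (Suc n - k)))
      = (1 - a * q ^ n) * (qpoch a q n / qpoch q q n)"
    unfolding Suc.IH .
  then show ?case
    using one_minus_power_nonzero[of n] qpoch_qq_nonzero[of n]
    by (simp add: qpoch_qq_Suc qpoch_Suc[of a] field_simps del: power_Suc sum.atMost_Suc)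
qed simp

text \<open>For \<open>u k = (-1)^k\<close> the convolution gives a factor \<open>1 - q^(n+1-k)\<close>, which cancels once more.  So the
recursion goes down by two, and Gauss's evaluation of the alternating sum of Gaussian binomials
follows separately for odd and even length.\<close>
lemma alternating_q_binomial_sum_rec:
  "(1 - q ^ Suc (Suc n)) * (\<Sum>k\<le>Suc (Suc n). (-1) ^ k / (qpoch q q k * qpoch q q (Suc (Suc n) - k)))
     = (\<Sum>k\<le>n. (-1) ^ k / (qpoch q q k * qpoch q q (n - k)))"
proof -
  have "(1 - q ^ (Suc n - k)) * ((-1) ^ k / (qpoch q q k * qpoch q q (Suc n - k)))
      = (-1) ^ k / (qpoch q q k * qpoch q q (n - k))" if "k \<le> n" for k
    using that one_minus_power_nonzero[of "n - k"] qpoch_qq_nonzero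
    by (simp add: Suc_diff_le qpoch_qq_Suc del: power_Suc)
  then have "(\<Sum>k\<le>Suc n. ((-1) ^ k + q ^ (Suc n - k) * (-1) ^ Suc k) / (qpoch q q k * qpoch q q (Suc n - k)))
     = (\<Sum>k\<le>n. (-1) ^ k / (qpoch q q k * qpoch q q (n - k)))"
    by (simp add: algebra_simps diff_divide_distrib)
  then show ?thesis
    by (subst q_pascal_convolution[where u = "\<lambda>k. (-1) ^ k"])
qed

lemma alternating_q_binomial_sum_odd:
  "(\<Sum>k\<le>Suc (2 * n). (-1) ^ k / (qpoch q q k * qpoch q q (Suc (2 * n) - k))) = 0"
proof (induction n)
  case (Suc n)
  have "(1 - q ^ Suc (Suc (Suc (2 * n)))) *
      (\<Sum>k\<le>Suc (Suc (Suc (2 * n))). (-1) ^ k / (qpoch q q k * qpoch q q (Suc (Suc (Suc (2 * n))) - k))) = 0"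
    using Suc by (subst alternating_q_binomial_sum_rec)
  then show ?case
    using one_minus_power_nonzero[of "Suc (Suc (2 * n))"] by (simp del: power_Suc sum.atMost_Suc)
qed simp

lemma alternating_q_binomial_sum_even:
  "(\<Sum>k\<le>2 * n. (-1) ^ k / (qpoch q q k * qpoch q q (2 * n - k))) = 1 / qpoch (q\<^sup>2) (q\<^sup>2) n"
proof (induction n)
  case (Suc n)
  have "q ^ Suc (Suc (2 * n)) = q\<^sup>2 * (q\<^sup>2) ^ n"
    by (simp add: power_mult)
       (simp add: power2_eq_square)
  then have "(1 - q\<^sup>2 * (q\<^sup>2) ^ n) *
      (\<Sum>k\<le>2 * Suc n. (-1) ^ k / (qpoch q q k * qpoch q q (2 * Suc n - k))) = 1 / qpoch (q\<^sup>2) (q\<^sup>2) n"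
    using alternating_q_binomial_sum_rec[of "2 * n"] Suc by simp
  moreover have "1 - q\<^sup>2 * (q\<^sup>2) ^ n \<noteq> 0"
    using one_minus_power_nonzero[of "Suc (2 * n)"] \<open>q ^ Suc (Suc (2 * n)) = q\<^sup>2 * (q\<^sup>2) ^ n\<close> by simp
  moreover have cancel: "c \<noteq> 0 \<Longrightarrow> c * s = 1 / d \<Longrightarrow> s = 1 / (d * c)" for c d s :: complex
    by (metis divide_divide_eq_left nonzero_mult_div_cancel_left)
  ultimately show ?case
    using cancel unfolding qpoch_Suc[of "q\<^sup>2"] by blast
qed simp

text \<open>Euler's expansion of \<open>(a;q)\<close> is the limit of the \<open>q\<close>-binomial theorem as the length grows.\<close>
lemma euler_expansion:
  "(\<lambda>k. (-1) ^ k * q ^ (k choose 2) * a ^ k / qpoch q q k) sums qpoch_inf a q"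
proof -
  obtain B where "B \<ge> 1 \<and> (\<forall>n. norm (qpoch q q n) \<le> B \<and> norm (1 / qpoch q q n) \<le> B)"
    using qpoch_qq_bounded by (rule exE)
  then have B: "B \<ge> 1" "\<And>n. norm (qpoch q q n) \<le> B" "\<And>n. norm (1 / qpoch q q n) \<le> B"
    by simp_all
  define f where "f n k = (if k \<le> n then (-1) ^ k * q ^ (k choose 2) * a ^ k / (qpoch q q k * qpoch q q (n - k)) else 0)" for n k
  \<comment> \<open>The bound \<open>B\<close> is used twice, for the two denominators of a summand.\<close>
  define M where "M k = B * B * (norm q ^ (k choose 2) * norm a ^ k)" for k
  have M: "summable M"
    unfolding M_def by (intro summable_mult summable_theta) (use q in auto)
  have bd: "norm (1 / qpoch q q i * (1 / qpoch q q j)) \<le> B * B" for i j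
    unfolding norm_mult using B by (intro mult_mono) auto
  have bound: "norm (f n k) \<le> M k" for n k
  proof (cases "k \<le> n")
    case True
    then have "f n k = (-1) ^ k * q ^ (k choose 2) * a ^ k * (1 / qpoch q q k * (1 / qpoch q q (n - k)))"
      by (simp add: f_def)
    then have "norm (f n k) = norm (1 / qpoch q q k * (1 / qpoch q q (n - k))) * (norm q ^ (k choose 2) * norm a ^ k)"
      by (simp only: norm_mult norm_power norm_minus_cancel norm_one power_one) simp
    also have "\<dots> \<le> M k"
      unfolding M_def by (intro mult_right_mono bd) auto
    finally show ?thesis .
  next
    case False
    then show ?thesis using B by (simp add: f_def M_def)
  qed
  let ?g = "\<lambda>k. (-1) ^ k * q ^ (k choose 2) * a ^ k / (qpoch q q k * qpoch_inf q q)"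
  have lim: "(\<lambda>n. f n k) \<longlonglongrightarrow> ?g k" for k
  proof (rule LIMSEQ_offset[of _ k])
    have "(\<lambda>n. (-1) ^ k * q ^ (k choose 2) * a ^ k / (qpoch q q k * qpoch q q n)) \<longlonglongrightarrow> ?g k"
      by (intro tendsto_intros qpoch_tendsto q) (use qpoch_qq_nonzero qpoch_inf_qq_nonzero in auto)
    then show "(\<lambda>n. f (n + k) k) \<longlonglongrightarrow> ?g k"
      by (simp add: f_def)
  qed
  have "suminf (f n) = qpoch a q n / qpoch q q n" for n
  proof -
    have "suminf (f n) = (\<Sum>k\<le>n. f n k)"
      by (rule suminf_finite) (auto simp: f_def)
    also have "\<dots> = qpoch a q n / qpoch q q n"
      unfolding q_binomial_theorem[symmetric] by (intro sum.cong) (auto simp: f_def)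
    finally show ?thesis .
  qed
  then have "(\<lambda>n. qpoch a q n / qpoch q q n) \<longlonglongrightarrow> suminf ?g"
    using tannery[of f ?g M, OF lim bound M] by simp
  moreover have "(\<lambda>n. qpoch a q n / qpoch q q n) \<longlonglongrightarrow> qpoch_inf a q / qpoch_inf q q"
    by (intro tendsto_intros qpoch_tendsto q qpoch_inf_qq_nonzero)
  ultimately have eq: "suminf ?g = qpoch_inf a q / qpoch_inf q q"
    by (rule LIMSEQ_unique)
  have "norm (?g k) \<le> M k" for k
    by (rule LIMSEQ_le_const2[OF tendsto_norm[OF lim]]) (use bound in auto)
  then have "summable ?g"
    by (intro summable_comparison_test'[OF M, of 0])
  then have "(\<lambda>k. ?g k * qpoch_inf q q) sums (qpoch_inf a q / qpoch_inf q q * qpoch_inf q q)"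
    unfolding eq[symmetric] by (intro sums_mult2 summable_sums)
  then show ?thesis
    using qpoch_inf_qq_nonzero by simp
qed

end

context
  fixes p :: complex
  assumes p: "norm p < 1"
begin

section \<open>Jacobi's triple product\<close>

text \<open>Reversing the factors \<open>1 - z p^(-i)\<close> and pulling out \<open>-z p^(-i)\<close> from each of them.  It rewrites the lower half
of \<open>(z p^(-n);p)\<close> of length \<open>2n\<close> in terms of \<open>w = p / z\<close>.\<close>
lemma qpoch_reflect:
  assumes zw: "z * w = p" and "p \<noteq> 0"
  shows "qpoch (z / p ^ n) p n = (-1) ^ n * z ^ n / p ^ (Suc n choose 2) * qpoch w p n"
proof (induction n)
  case (Suc n)
  have "1 - z / p ^ Suc n = - (z / p ^ Suc n) * (1 - w * p ^ n)"
    using \<open>p \<noteq> 0\<close> by (simp add: zw[symmetric] field_simps)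
  moreover have "qpoch (z / p ^ Suc n) p (Suc n) = (1 - z / p ^ Suc n) * qpoch (z / p ^ n) p n"
    using qpoch_add[of "z / p ^ Suc n" p 1 n] \<open>p \<noteq> 0\<close> by (simp add: qpoch_def)
  ultimately have "qpoch (z / p ^ Suc n) p (Suc n)
      = - (z / p ^ Suc n) * (1 - w * p ^ n) * ((-1) ^ n * z ^ n / p ^ (Suc n choose 2) * qpoch w p n)"
    by (simp only: Suc)
  then show ?case
    unfolding qpoch_Suc[of w] Suc_choose_two[of "Suc n"] power_add by (simp add: mult_ac)
qed (simp add: Suc_choose_two)

text \<open>The \<open>q\<close>-binomial theorem of length \<open>2n\<close> at \<open>a = z p^(-n)\<close>, with the summation index recentred at \<open>n\<close>.
The terms on the two sides of the centre carry powers of \<open>z\<close> and of \<open>w\<close>; writing \<open>z w = p\<close> keeps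
negative exponents out of the statement.\<close>
lemma finite_jacobi_triple_product:
  assumes zw: "z * w = p" and "p \<noteq> 0"
  shows "qpoch z p n * qpoch w p n / qpoch p p (2 * n)
    = (\<Sum>r\<le>n. (-1) ^ r * p ^ (r choose 2) * z ^ r / (qpoch p p (n + r) * qpoch p p (n - r)))
      - (\<Sum>r<n. (-1) ^ r * p ^ (Suc r choose 2) * w ^ Suc r
             / (qpoch p p (n + Suc r) * qpoch p p (n - Suc r)))"
proof -
  have z: "z \<noteq> 0" using zw \<open>p \<noteq> 0\<close> by auto
  \<comment> \<open>The common factor of all terms and of the product at \<open>a = z p^(-n)\<close>, relative to their recentred forms.\<close>
  define K where "K = (-1) ^ n * z ^ n / p ^ (Suc n choose 2)"
  have K: "K \<noteq> 0" using z \<open>p \<noteq> 0\<close> by (simp add: K_def)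
  define u where "u k = (-1) ^ k * p ^ (k choose 2) * (z / p ^ n) ^ k" for k
  have nn: "n * n = (n choose 2) + (Suc n choose 2)"
    by (induction n) (simp_all add: Suc_choose_two)
  have upper: "u (n + r) = K * ((-1) ^ r * p ^ (r choose 2) * z ^ r)" for r
  proof -
    have "(p ^ n) ^ (n + r) = p ^ (n choose 2) * p ^ (Suc n choose 2) * p ^ (n * r)"
      by (simp add: power_mult[symmetric] nn distrib_left power_add)
    then show ?thesis
      using \<open>p \<noteq> 0\<close>
      by (simp add: u_def K_def add_choose_two power_add power_divide)
  qed
  have lower: "u (n - Suc r) = K * (- ((-1) ^ r * p ^ (Suc r choose 2) * w ^ Suc r))"
    if "r < n" for r
  proof -
    define m where "m = n - Suc r"
    have n: "n = m + Suc r" using that by (simp add: m_def)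
    have mm: "m * m = 2 * (m choose 2) + m"
      by (induction m) (simp_all add: Suc_choose_two)
    have "(m choose 2) + (Suc n choose 2) = n * m + (Suc r choose 2) + Suc r"
      unfolding n by (simp add: add_choose_two Suc_choose_two mm distrib_left distrib_right)
    then have exps: "p ^ (m choose 2) * p ^ (Suc n choose 2) = p ^ (n * m) * p ^ (Suc r choose 2) * p ^ Suc r"
      by (simp only: power_add[symmetric])
    have zs: "z ^ n * w ^ Suc r = z ^ m * p ^ Suc r"
      unfolding n zw[symmetric] power_add power_mult_distrib by simp
    have sg: "(-1) ^ n * (- ((-1) ^ r)) = ((-1) ^ m :: complex)"
      unfolding n by (simp add: power_add)
    have "K * (- ((-1) ^ r * p ^ (Suc r choose 2) * w ^ Suc r))
        = ((-1) ^ n * (- ((-1) ^ r))) * (z ^ n * w ^ Suc r) * p ^ (Suc r choose 2) / p ^ (Suc n choose 2)"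
      by (simp add: K_def)
    also have "\<dots> = (-1) ^ m * z ^ m * (p ^ (n * m) * p ^ (Suc r choose 2) * p ^ Suc r)
                     / (p ^ (n * m) * p ^ (Suc n choose 2))"
      unfolding sg zs using \<open>p \<noteq> 0\<close> by simp
    also have "\<dots> = u m"
      unfolding exps[symmetric] using \<open>p \<noteq> 0\<close>
      by (simp add: u_def power_divide power_mult)
    finally show ?thesis unfolding m_def ..
  qed
  have "qpoch (z / p ^ n) p (2 * n) = K * (qpoch z p n * qpoch w p n)"
    using qpoch_add[of "z / p ^ n" p n n] qpoch_reflect[OF assms, of n] \<open>p \<noteq> 0\<close>
    by (simp add: K_def mult_2)
  then have "K * (qpoch z p n * qpoch w p n / qpoch p p (2 * n))
      = (\<Sum>k\<le>2 * n. u k / (qpoch p p k * qpoch p p (2 * n - k)))"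
    using q_binomial_theorem[OF p, where n = "2 * n" and a = "z / p ^ n"] by (simp add: u_def)
  also have "\<dots> = (\<Sum>k<n. u k / (qpoch p p k * qpoch p p (2 * n - k)))
      + (\<Sum>r\<le>n. u (n + r) / (qpoch p p (n + r) * qpoch p p (2 * n - (n + r))))"
  proof -
    have "{..2 * n} = {..<n} \<union> {n..2 * n}" by auto
    then have "(\<Sum>k\<le>2 * n. u k / (qpoch p p k * qpoch p p (2 * n - k)))
      = (\<Sum>k<n. u k / (qpoch p p k * qpoch p p (2 * n - k)))
       + (\<Sum>k=n..2 * n. u k / (qpoch p p k * qpoch p p (2 * n - k)))"
      by (simp add: sum.union_disjoint ivl_disj_int)
    also have "(\<Sum>k=n..2 * n. u k / (qpoch p p k * qpoch p p (2 * n - k)))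
        = (\<Sum>r\<le>n. u (n + r) / (qpoch p p (n + r) * qpoch p p (2 * n - (n + r))))"
      by (rule sum.reindex_bij_witness[of _ "\<lambda>r. n + r" "\<lambda>k. k - n"]) auto
    finally show ?thesis .
  qed
  also have "(\<Sum>k<n. u k / (qpoch p p k * qpoch p p (2 * n - k)))
      = (\<Sum>r<n. u (n - Suc r) / (qpoch p p (n - Suc r) * qpoch p p (2 * n - (n - Suc r))))"
    by (rule sum.nat_diff_reindex[symmetric])
  also have "\<dots> = - (K * (\<Sum>r<n. (-1) ^ r * p ^ (Suc r choose 2) * w ^ Suc r
             / (qpoch p p (n + Suc r) * qpoch p p (n - Suc r))))"
  proof -
    have "u (n - Suc r) / (qpoch p p (n - Suc r) * qpoch p p (2 * n - (n - Suc r)))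
        = - (K * ((-1) ^ r * p ^ (Suc r choose 2) * w ^ Suc r
             / (qpoch p p (n + Suc r) * qpoch p p (n - Suc r))))" if "r < n" for r
    proof -
      have "2 * n - (n - Suc r) = n + Suc r" using that by simp
      then show ?thesis unfolding lower[OF that] by (simp add: mult.commute)
    qed
    then show ?thesis
      by (simp add: sum_distrib_left sum_negf)
  qed
  also have "(\<Sum>r\<le>n. u (n + r) / (qpoch p p (n + r) * qpoch p p (2 * n - (n + r))))
      = K * (\<Sum>r\<le>n. (-1) ^ r * p ^ (r choose 2) * z ^ r / (qpoch p p (n + r) * qpoch p p (n - r)))"
    unfolding upper by (simp add: sum_distrib_left mult_2)
  finally have "K * (qpoch z p n * qpoch w p n / qpoch p p (2 * n)) =
      K * ((\<Sum>r\<le>n. (-1) ^ r * p ^ (r choose 2) * z ^ r / (qpoch p p (n + r) * qpoch p p (n - r)))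
      - (\<Sum>r<n. (-1) ^ r * p ^ (Suc r choose 2) * w ^ Suc r
             / (qpoch p p (n + Suc r) * qpoch p p (n - Suc r))))"
    by (simp only: right_diff_distrib) simp
  then show ?thesis
    using K by (simp only: mult_cancel_left simp_thms)
qed

text \<open>The bilateral theta series, with the terms of index \<open>r\<close> and \<open>-(r+1)\<close> combined into one unilateral series.\<close>
lemma jacobi_triple_product:
  assumes zw: "z * w = p" and "p \<noteq> 0"
  shows "(\<lambda>r. (-1) ^ r * (p ^ (r choose 2) * z ^ r - p ^ (Suc r choose 2) * w ^ Suc r))
           sums (qpoch_inf z p * qpoch_inf w p * qpoch_inf p p)"
proof -
  let ?P = "qpoch p p" and ?Pi = "qpoch_inf p p"
  obtain B where "B \<ge> 1 \<and> (\<forall>n. norm (?P n) \<le> B \<and> norm (1 / ?P n) \<le> B)"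
    using qpoch_qq_bounded[OF p] by (rule exE)
  then have B: "B \<ge> 1" "\<And>n. norm (1 / ?P n) \<le> B"
    by simp_all
  define c where "c r = (-1) ^ r * (p ^ (r choose 2) * z ^ r)" for r
  define d where "d r = (-1) ^ r * (p ^ (Suc r choose 2) * w ^ Suc r)" for r
  \<comment> \<open>Both halves of the finite identity at level \<open>n\<close>, extended by \<open>0\<close>; the upper half has one more term.\<close>
  define f where "f n r = (if r \<le> n then c r * (1 / ?P (n + r) * (1 / ?P (n - r))) else 0)
     - (if r < n then d r * (1 / ?P (n + Suc r) * (1 / ?P (n - Suc r))) else 0)" for n r
  define M where "M r = norm (c r) * (B * B) + norm (d r) * (B * B)" for r
  have sc: "summable (\<lambda>r. norm (c r))"
    using summable_theta[of "norm p" "norm z"] p by (simp add: c_def norm_mult norm_power)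
  have "summable (\<lambda>r. norm p ^ (Suc r choose 2) * norm w ^ Suc r)"
    by (subst summable_Suc_iff) (use summable_theta[of "norm p" "norm w"] p in simp)
  then have sd: "summable (\<lambda>r. norm (d r))"
    by (simp add: d_def norm_mult norm_power)
  have M: "summable M"
    unfolding M_def by (intro summable_add summable_mult2 sc sd)
  have bd: "norm (1 / ?P i * (1 / ?P j)) \<le> B * B" for i j
    unfolding norm_mult using B by (intro mult_mono) auto
  have bound: "norm (f n r) \<le> M r" for n r
  proof -
    have B0: "0 \<le> B * B" using B by auto
    have "norm (if b then x * y else 0) \<le> norm x * (B * B)" if "norm y \<le> B * B" for b and x y :: complex
      using that B0 by (auto simp: norm_mult intro: mult_left_mono)
    from this[OF bd] show ?thesis
      unfolding f_def M_def by (intro norm_triangle_le_diff add_mono)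
  qed
  have lim: "(\<lambda>n. f n r) \<longlonglongrightarrow> c r * (1 / ?Pi * (1 / ?Pi)) - d r * (1 / ?Pi * (1 / ?Pi))" for r
  proof (rule LIMSEQ_offset[of _ "Suc r"])
    have shift: "(\<lambda>n. ?P (n + k)) \<longlonglongrightarrow> ?Pi" for k
      by (rule LIMSEQ_ignore_initial_segment[OF qpoch_tendsto[OF p]])
    have "(\<lambda>n. c r * (1 / ?P (n + (Suc r + r)) * (1 / ?P (n + 1)))
         - d r * (1 / ?P (n + (Suc r + Suc r)) * (1 / ?P (n + 0))))
       \<longlonglongrightarrow> c r * (1 / ?Pi * (1 / ?Pi)) - d r * (1 / ?Pi * (1 / ?Pi))"
      by (intro tendsto_intros shift qpoch_inf_qq_nonzero p)
    moreover have "f (n + Suc r) r = c r * (1 / ?P (n + (Suc r + r)) * (1 / ?P (n + 1)))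
         - d r * (1 / ?P (n + (Suc r + Suc r)) * (1 / ?P (n + 0)))" for n
      by (simp add: f_def add.assoc)
    ultimately show "(\<lambda>n. f (n + Suc r) r) \<longlonglongrightarrow> c r * (1 / ?Pi * (1 / ?Pi)) - d r * (1 / ?Pi * (1 / ?Pi))"
      by simp
  qed
  have "suminf (f n) = qpoch z p n * qpoch w p n / ?P (2 * n)" for n
  proof -
    have "suminf (f n) = (\<Sum>r\<le>n. f n r)"
      by (rule suminf_finite) (auto simp: f_def)
    also have "\<dots> = (\<Sum>r\<le>n. c r * (1 / ?P (n + r) * (1 / ?P (n - r))))
       - (\<Sum>r\<le>n. if r < n then d r * (1 / ?P (n + Suc r) * (1 / ?P (n - Suc r))) else 0)"
      unfolding f_def sum_subtractf by simp
    also have "(\<Sum>r\<le>n. if r < n then d r * (1 / ?P (n + Suc r) * (1 / ?P (n - Suc r))) else 0)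
       = (\<Sum>r<n. d r * (1 / ?P (n + Suc r) * (1 / ?P (n - Suc r))))"
      by (rule sum.mono_neutral_cong_right) auto
    finally show ?thesis
      unfolding finite_jacobi_triple_product[OF assms] by (simp add: c_def d_def mult.assoc)
  qed
  then have "(\<lambda>n. qpoch z p n * qpoch w p n / ?P (2 * n))
       \<longlonglongrightarrow> (\<Sum>r. c r * (1 / ?Pi * (1 / ?Pi)) - d r * (1 / ?Pi * (1 / ?Pi)))"
    using tannery[of f _ M, OF lim bound M] by simp
  moreover have "(\<lambda>n. qpoch z p n * qpoch w p n / ?P (2 * n))
       \<longlonglongrightarrow> qpoch_inf z p * qpoch_inf w p / ?Pi"
  proof -
    have "(\<lambda>n. ?P (2 * n)) \<longlonglongrightarrow> ?Pi"
      using LIMSEQ_subseq_LIMSEQ[OF qpoch_tendsto[OF p], of "\<lambda>n. 2 * n"]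
      by (simp add: strict_mono_def o_def)
    then show ?thesis
      by (intro tendsto_intros qpoch_tendsto p qpoch_inf_qq_nonzero)
  qed
  ultimately have eq: "(\<Sum>r. c r * (1 / ?Pi * (1 / ?Pi)) - d r * (1 / ?Pi * (1 / ?Pi)))
      = qpoch_inf z p * qpoch_inf w p / ?Pi"
    by (rule LIMSEQ_unique)
  have summ: "summable (\<lambda>r. c r - d r)"
    by (intro summable_diff summable_norm_cancel[OF sc] summable_norm_cancel[OF sd])
  have "(\<Sum>r. (c r - d r) * (1 / ?Pi * (1 / ?Pi))) = qpoch_inf z p * qpoch_inf w p / ?Pi"
    using eq by (simp only: left_diff_distrib)
  then have "(\<Sum>r. c r - d r) * (1 / ?Pi * (1 / ?Pi)) = qpoch_inf z p * qpoch_inf w p / ?Pi"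
    by (simp only: suminf_mult2[OF summ])
  then have "(\<Sum>r. c r - d r) = qpoch_inf z p * qpoch_inf w p * ?Pi"
    using qpoch_inf_qq_nonzero[OF p] by (simp add: field_simps)
  then show ?thesis
    using summable_sums[OF summ] by (simp add: c_def d_def right_diff_distrib)
qed

end

section \<open>Rogers-Ramanujan identities\<close>

definition rr_sum :: "complex \<Rightarrow> nat \<Rightarrow> complex" where
  "rr_sum q m = (\<Sum>k. q ^ (k\<^sup>2 + m * k) / qpoch q q k)"

text \<open>These are the terms of the auxiliary series in the classical proof of Rogers and Ramanujan (in Hardy and Wright's form,
the functions \<open>H\<^sub>2\<close> and \<open>H\<^sub>1\<close>), taken at the argument \<open>q^(m+1)\<close> and multiplied by \<open>(q;q)\<close>.  Specialised
to such arguments, the infinite product in each term becomes the finite quotient \<open>(q;q)\<^sub>m\<^sub>+\<^sub>r / (q;q)\<^sub>r\<close>.\<close>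
definition rogers_V :: "complex \<Rightarrow> nat \<Rightarrow> nat \<Rightarrow> complex" where
  "rogers_V q m r = (-1) ^ r * q ^ (5 * (r choose 2) + (2 * m + 3) * r) * (1 - q ^ (2 * m + 2 + 4 * r))
     * (qpoch q q (m + r) / qpoch q q r)"

definition rogers_U :: "complex \<Rightarrow> nat \<Rightarrow> nat \<Rightarrow> complex" where
  "rogers_U q m r = (-1) ^ r * q ^ (5 * (r choose 2) + (2 * m + 4) * r) * (1 - q ^ (m + 1 + 2 * r))
     * (qpoch q q (m + r) / qpoch q q r)"

text \<open>The partial products of \<open>\<Prod>(1 + t^k)\<close> control both the growth and the decay of solutions of the
three-term recursions \<open>d\<^sub>m = d\<^sub>m\<^sub>+\<^sub>1 + q^(m+1) d\<^sub>m\<^sub>+\<^sub>2\<close> and \<open>a\<^sub>m\<^sub>+\<^sub>2 = a\<^sub>m\<^sub>+\<^sub>1 + q^m a\<^sub>m\<close>.\<close>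
lemma bounded_partial_products:
  fixes t :: real
  assumes t: "0 \<le> t" "t < 1"
  shows "\<exists>P::nat \<Rightarrow> real. (\<forall>m. P m \<ge> 1 \<and> P (Suc m) = P m * (1 + t ^ m)) \<and> Bseq P"
proof -
  define P where "P m = (\<Prod>k<m. 1 + t ^ k)" for m
  have "abs_convergent_prod (\<lambda>k. 1 + t ^ k)"
    by (rule summable_imp_abs_convergent_prod) (use t in \<open>simp add: power_abs\<close>)
  then have "(\<lambda>n. \<Prod>k\<le>n. 1 + t ^ k) \<longlonglongrightarrow> (\<Prod>k. 1 + t ^ k)"
    by (intro convergent_prod_LIMSEQ abs_convergent_prod_imp_convergent_prod)
  then have "(\<lambda>n. P (Suc n)) \<longlonglongrightarrow> (\<Prod>k. 1 + t ^ k)"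
    by (simp add: P_def lessThan_Suc_atMost)
  then have "P \<longlonglongrightarrow> (\<Prod>k. 1 + t ^ k)"
    by (rule LIMSEQ_imp_Suc)
  then have "Bseq P"
    by (intro convergent_imp_Bseq convergentI)
  moreover have "P m \<ge> 1" for m
    unfolding P_def by (intro prod_ge_1) (use t in simp)
  moreover have "P (Suc m) = P m * (1 + t ^ m)" for m
    by (simp add: P_def)
  ultimately show ?thesis
    by (intro exI[of _ P] conjI allI)
qed

context
  fixes q :: complex
  assumes q: "norm q < 1"
begin

text \<open>Weighted by the partial products \<open>P\<^sub>m\<close>, the maximum \<open>E\<^sub>m\<close> of two neighbouring absolute values is nondecreasing;
as it also tends to \<open>0\<close>, it vanishes.  Hence a solution of the recursion is determined by its limit.\<close>
lemma backward_recursion_unique: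
  fixes d :: "nat \<Rightarrow> complex"
  assumes rec: "\<And>m. d m = d (Suc m) + q ^ Suc m * d (Suc (Suc m))"
    and lim: "d \<longlonglongrightarrow> 0"
  shows "d m = 0"
proof -
  have "\<exists>P::nat \<Rightarrow> real. (\<forall>m. P m \<ge> 1 \<and> P (Suc m) = P m * (1 + norm q ^ m)) \<and> Bseq P"
    by (rule bounded_partial_products) (use q in auto)
  then obtain P :: "nat \<Rightarrow> real" where "(\<forall>m. P m \<ge> 1 \<and> P (Suc m) = P m * (1 + norm q ^ m)) \<and> Bseq P"
    by (rule exE)
  then have P: "\<And>m. P m \<ge> 1" "\<And>m. P (Suc m) = P m * (1 + norm q ^ m)" "Bseq P"
    by simp_all
  obtain K where K: "\<And>m. norm (P m) \<le> K"
    using P(3) by (meson BseqE)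
  define E where "E m = max (norm (d m)) (norm (d (Suc m)))" for m
  have E0: "E m \<ge> 0" for m by (simp add: E_def le_max_iff_disj)
  have step: "E m \<le> (1 + norm q ^ m) * E (Suc m)" for m
  proof -
    have E1: "norm (d (Suc m)) \<le> E (Suc m)" "norm (d (Suc (Suc m))) \<le> E (Suc m)"
      by (simp_all only: E_def max.cobounded1 max.cobounded2)
    have "norm q ^ Suc m \<le> norm q ^ m"
      by (rule power_decreasing) (use q in simp_all)
    then have "norm q ^ Suc m * norm (d (Suc (Suc m))) \<le> norm q ^ m * E (Suc m)"
      by (rule mult_mono) (simp_all add: E1)
    moreover have "norm (d m) \<le> norm (d (Suc m)) + norm q ^ Suc m * norm (d (Suc (Suc m)))"
      using norm_triangle_ineq[of "d (Suc m)" "q ^ Suc m * d (Suc (Suc m))"]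
      unfolding rec[of m, symmetric] norm_mult norm_power .
    moreover have "0 \<le> norm q ^ m * E (Suc m)"
      by (simp add: E0)
    ultimately have "norm (d m) \<le> E (Suc m) + norm q ^ m * E (Suc m)"
      "norm (d (Suc m)) \<le> E (Suc m) + norm q ^ m * E (Suc m)"
      using E1 by linarith+
    then show ?thesis
      unfolding E_def[of m] distrib_right mult_1_left by (rule max.boundedI)
  qed
  have "incseq (\<lambda>m. P m * E m)"
  proof (rule incseq_SucI)
    fix m
    have "P m * E m \<le> P m * ((1 + norm q ^ m) * E (Suc m))"
      using P(1)[of m] by (intro mult_left_mono step) auto
    then show "P m * E m \<le> P (Suc m) * E (Suc m)"
      by (simp add: P(2) mult.assoc)
  qed
  moreover have "(\<lambda>m. P m * E m) \<longlonglongrightarrow> 0"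
  proof -
    have "(\<lambda>m. max (norm (d m)) (norm (d (Suc m)))) \<longlonglongrightarrow> max (norm (0::complex)) (norm (0::complex))"
      by (intro tendsto_max tendsto_norm lim LIMSEQ_Suc[OF lim])
    then have "E \<longlonglongrightarrow> 0"
      unfolding E_def[abs_def] by (simp only: norm_zero max.idem)
    then have "(\<lambda>m. K * E m) \<longlonglongrightarrow> 0"
      by (rule tendsto_mult_right_zero)
    moreover have "norm (P m * E m) \<le> K * E m" for m
      using mult_right_mono[OF K[of m] E0[of m]] E0[of m] by (simp only: real_norm_def abs_mult abs_of_nonneg)
    then have "\<forall>\<^sub>F m in sequentially. norm (P m * E m) \<le> K * E m"
      by (rule always_eventually[OF allI])
    ultimately show ?thesis
      by (rule Lim_null_comparison[rotated])
  qed
  ultimately have "P m * E m \<le> 0"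
    by (rule incseq_le)
  then have "E m \<le> 0"
    using P(1)[of m] by (simp add: mult_le_0_iff)
  then show ?thesis
    by (simp add: E_def)
qed

lemma rr_sum_term_bound:
  assumes "norm (1 / qpoch q q k) \<le> B"
  shows "norm (q ^ (k\<^sup>2 + m * k) / qpoch q q k) \<le> B * norm q ^ k"
proof -
  have "norm q ^ (k\<^sup>2 + m * k) \<le> norm q ^ k"
    using q by (intro power_decreasing) (auto simp: power2_eq_square intro: trans_le_add1)
  then have "norm q ^ (k\<^sup>2 + m * k) * norm (1 / qpoch q q k) \<le> norm q ^ k * B"
    using assms by (intro mult_mono) auto
  then show ?thesis
    by (simp add: norm_mult norm_divide norm_power mult.commute)
qed

lemma rr_sum_summable: "summable (\<lambda>k. norm (q ^ (k\<^sup>2 + m * k) / qpoch q q k))"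
proof -
  obtain B where "B \<ge> 1 \<and> (\<forall>n. norm (qpoch q q n) \<le> B \<and> norm (1 / qpoch q q n) \<le> B)"
    using qpoch_qq_bounded[OF q] by (rule exE)
  then have B: "\<And>n. norm (1 / qpoch q q n) \<le> B" by simp
  have "summable (\<lambda>k. B * norm q ^ k)"
    using q by (intro summable_mult summable_geometric) auto
  then show ?thesis
    by (rule summable_comparison_test'[of _ 0]) (use rr_sum_term_bound[OF B] in simp)
qed

text \<open>In the difference of the two series, \<open>1 - q^k\<close> cancels against \<open>(q;q)\<^sub>k\<close>, and the index shift
completes the square.\<close>
lemma rr_sum_rec: "rr_sum q m = rr_sum q (Suc m) + q ^ Suc m * rr_sum q (Suc (Suc m))"
proof -
  let ?s = "\<lambda>m k. q ^ (k\<^sup>2 + m * k) / qpoch q q k"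
  have summ: "summable (?s i)" for i
    by (rule summable_norm_cancel[OF rr_sum_summable])
  have d: "?s m (Suc k) - ?s (Suc m) (Suc k) = q ^ Suc m * ?s (Suc (Suc m)) k" for k
  proof -
    have "(Suc k)\<^sup>2 + m * Suc k = Suc m + (k\<^sup>2 + Suc (Suc m) * k)"
      by (simp add: power2_eq_square)
    moreover have "(Suc k)\<^sup>2 + Suc m * Suc k = Suc m + (k\<^sup>2 + Suc (Suc m) * k) + Suc k"
      by (simp add: power2_eq_square)
    ultimately have "?s m (Suc k) - ?s (Suc m) (Suc k)
       = q ^ Suc m * q ^ (k\<^sup>2 + Suc (Suc m) * k) * (1 - q ^ Suc k) / qpoch q q (Suc k)"
      by (simp only: power_add right_diff_distrib diff_divide_distrib) simp
    then show ?thesis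
      using one_minus_power_nonzero[OF q, of k] by (simp only: qpoch_qq_Suc[OF q]) simp
  qed
  have "rr_sum q m - rr_sum q (Suc m) = (\<Sum>k. ?s m k - ?s (Suc m) k)"
    unfolding rr_sum_def by (intro suminf_diff summ)
  also have "\<dots> = (\<Sum>k. ?s m (Suc k) - ?s (Suc m) (Suc k))"
    using suminf_split_head[OF summable_diff[OF summ[of m] summ[of "Suc m"]]] by simp
  also have "\<dots> = q ^ Suc m * rr_sum q (Suc (Suc m))"
    unfolding d rr_sum_def by (intro suminf_mult summ)
  finally show ?thesis
    by (simp add: algebra_simps)
qed

lemma rr_sum_tendsto: "rr_sum q \<longlonglongrightarrow> 1"
proof -
  obtain B where "B \<ge> 1 \<and> (\<forall>n. norm (qpoch q q n) \<le> B \<and> norm (1 / qpoch q q n) \<le> B)"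
    using qpoch_qq_bounded[OF q] by (rule exE)
  then have B: "\<And>n. norm (1 / qpoch q q n) \<le> B" by simp
  have "(\<lambda>m. q ^ (k\<^sup>2 + m * k) / qpoch q q k) \<longlonglongrightarrow> (if k = 0 then 1 else 0)" for k
  proof (cases "k = 0")
    case False
    have "norm (q ^ k) < 1"
      using q False power_less_one_iff[of "norm q" k] by (simp add: norm_power)
    then have "(\<lambda>m. q ^ k\<^sup>2 / qpoch q q k * (q ^ k) ^ m) \<longlonglongrightarrow> q ^ k\<^sup>2 / qpoch q q k * 0"
      by (intro tendsto_intros LIMSEQ_power_zero)
    then show ?thesis
      using False by (simp add: power_add power_mult[symmetric] mult.commute)
  qed simp
  moreover have "summable (\<lambda>k. B * norm q ^ k)"
    using q by (intro summable_mult summable_geometric) auto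
  ultimately have "(\<lambda>m. \<Sum>k. q ^ (k\<^sup>2 + m * k) / qpoch q q k) \<longlonglongrightarrow> (\<Sum>k. if k = 0 then 1 else 0)"
    by (intro tannery[where M = "\<lambda>k. B * norm q ^ k"] rr_sum_term_bound B)
  moreover have "(\<Sum>k::nat. if k = 0 then 1 else 0) = (1::complex)"
    using suminf_finite[of "{0}" "\<lambda>k::nat. if k = 0 then 1 else (0::complex)"] by simp
  ultimately show ?thesis
    unfolding rr_sum_def[abs_def] by simp
qed

lemma rogers_term_bound:
  assumes B: "norm (qpoch q q i) \<le> B" "norm (1 / qpoch q q r) \<le> B" "B \<ge> 1" and "e \<ge> c"
  shows "norm ((-1) ^ r * q ^ e * (1 - q ^ b) * (qpoch q q i / qpoch q q r)) \<le> 2 * (B * B) * norm q ^ c"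
proof -
  have "norm (1 - q ^ b) \<le> norm (1::complex) + norm (q ^ b)"
    by (rule norm_triangle_ineq4)
  also have "\<dots> \<le> 2"
    using q by (simp add: norm_power power_le_one)
  finally have 1: "norm (1 - q ^ b) \<le> 2" .
  have 2: "norm (qpoch q q i * (1 / qpoch q q r)) \<le> B * B"
    unfolding norm_mult using B by (intro mult_mono) auto
  have 3: "norm q ^ e \<le> norm q ^ c"
    using q \<open>e \<ge> c\<close> by (intro power_decreasing) auto
  have "norm (1 - q ^ b) * norm (qpoch q q i * (1 / qpoch q q r)) * norm q ^ e
      \<le> 2 * (B * B) * norm q ^ c"
    by (intro mult_mono 1 2 3) (use B in auto)
  then show ?thesis
    by (simp add: norm_mult norm_divide norm_power mult_ac)
qed

lemma rogers_series_summable: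
  assumes "\<And>r. r \<le> e r"
  shows "summable (\<lambda>r. (-1) ^ r * q ^ e r * (1 - q ^ b r) * (qpoch q q (i r) / qpoch q q r))"
proof -
  obtain B where "B \<ge> 1 \<and> (\<forall>n. norm (qpoch q q n) \<le> B \<and> norm (1 / qpoch q q n) \<le> B)"
    using qpoch_qq_bounded[OF q] by (rule exE)
  then have B: "B \<ge> 1" "\<And>n. norm (qpoch q q n) \<le> B" "\<And>n. norm (1 / qpoch q q n) \<le> B"
    by simp_all
  have "summable (\<lambda>r. 2 * (B * B) * norm q ^ r)"
    using q by (intro summable_mult summable_geometric) auto
  then show ?thesis
    by (rule summable_comparison_test'[of _ 0]) (intro rogers_term_bound B assms)
qed

lemma rogers_V_summable: "summable (rogers_V q m)"
  unfolding rogers_V_def by (rule rogers_series_summable) (simp add: distrib_right)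

lemma rogers_U_summable: "summable (rogers_U q m)"
  unfolding rogers_U_def by (rule rogers_series_summable) (simp add: distrib_right)

text \<open>The terms of the two series differ by a telescoping difference \<open>Q\<^sub>r - Q\<^sub>r\<^sub>+\<^sub>1\<close>: in \<open>rogers_U\<close> the factor
\<open>1 - q^(m+1+2r)\<close> splits into a multiple of \<open>1 - q^r\<close>, which lowers \<open>(q;q)\<^sub>r\<close>, and a multiple of \<open>1 - q^(m+1+r)\<close>,
which raises \<open>(q;q)\<^sub>m\<^sub>+\<^sub>r\<close>.\<close>
lemma rogers_U_eq_V: "suminf (rogers_U q m) = suminf (rogers_V q (Suc m))"
proof -
  \<comment> \<open>The part of \<open>rogers_U q m r\<close> that contains \<open>1 - q^r\<close>; the rest is a part of \<open>rogers_V q (Suc m) r\<close>.\<close>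
  define Q where "Q r = (-1) ^ r * q ^ (5 * (r choose 2) + (2 * m + 4) * r) * (1 - q ^ r)
     * (qpoch q q (m + r) / qpoch q q r)" for r
  \<comment> \<open>In \<open>Q (Suc r)\<close> the factor \<open>1 - q^(r+1)\<close> cancels, which leaves, up to sign, the other part of \<open>rogers_V q (Suc m) r\<close>.\<close>
  have QSuc: "Q (Suc r) = - ((-1) ^ r * q ^ (5 * (r choose 2) + (2 * m + 5) * r)
      * q ^ (2 * m + 4 + 4 * r) * (qpoch q q (m + Suc r) / qpoch q q r))" for r
  proof -
    have e: "5 * (Suc r choose 2) + (2 * m + 4) * Suc r = 5 * (r choose 2) + (2 * m + 5) * r + (2 * m + 4 + 4 * r)"
      by (simp add: Suc_choose_two algebra_simps)
    have "(1 - q ^ Suc r) * (qpoch q q (m + Suc r) / qpoch q q (Suc r)) = qpoch q q (m + Suc r) / qpoch q q r"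
      using one_minus_power_nonzero[OF q, of r] by (simp only: qpoch_qq_Suc[OF q]) simp
    then show ?thesis
      unfolding Q_def e power_add[of q "5 * (r choose 2) + (2 * m + 5) * r"] mult.assoc by simp
  qed
  have P: "rogers_U q m r = Q r + (-1) ^ r * q ^ (5 * (r choose 2) + (2 * m + 5) * r)
     * (qpoch q q (m + Suc r) / qpoch q q r)" for r
  proof -
    define E where "E = q ^ (5 * (r choose 2) + (2 * m + 4) * r)"
    have "(2 * m + 5) * r = (2 * m + 4) * r + r"
      using distrib_right[of "2 * m + 4" 1 r] by (simp only: add.assoc numeral_plus_one semiring_norm mult_1_left)
    then have E5: "q ^ (5 * (r choose 2) + (2 * m + 5) * r) = E * q ^ r"
      unfolding E_def power_add[symmetric] by (simp only: add.assoc)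
    have step: "qpoch q q (m + Suc r) = (1 - q ^ (m + 1 + r)) * qpoch q q (m + r)"
      using qpoch_qq_Suc[OF q, of "m + r"] by simp
    have dec: "1 - q ^ (m + 1 + 2 * r) = (1 - q ^ r) + q ^ r * (1 - q ^ (m + 1 + r))"
    proof -
      have "q ^ (m + 1 + 2 * r) = q ^ r * q ^ (m + 1 + r)"
        unfolding power_add[symmetric] by (rule arg_cong[of _ _ "(^) q"]) simp
      then show ?thesis by (simp only: right_diff_distrib) simp
    qed
    have expand: "s * E * (A + x * C) * (W / w) = s * E * A * (W / w) + s * (E * x) * (C * W / w)"
      for s A x C W w
      by (simp add: algebra_simps)
    show ?thesis
      unfolding rogers_U_def Q_def E5 E_def[symmetric] step dec by (rule expand)
  qed
  have "rogers_U q m r - rogers_V q (Suc m) r = Q r - Q (Suc r)" for r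
  proof -
    have V: "rogers_V q (Suc m) r = (-1) ^ r * q ^ (5 * (r choose 2) + (2 * m + 5) * r)
        * (1 - q ^ (2 * m + 4 + 4 * r)) * (qpoch q q (m + Suc r) / qpoch q q r)"
    proof -
      have "2 * Suc m + 3 = 2 * m + 5" "2 * Suc m + 2 = 2 * m + 4" "Suc m + r = m + Suc r"
        by simp_all
      then show ?thesis unfolding rogers_V_def by (simp only:)
    qed
    have collect: "A + s * F * W - s * F * (1 - G) * W = A - - (s * F * G * W)" for A s F G W :: complex
      by (simp add: algebra_simps)
    show ?thesis
      unfolding P QSuc V by (rule collect)
  qed
  moreover have "Q \<longlonglongrightarrow> 0"
    unfolding Q_def by (intro summable_LIMSEQ_zero rogers_series_summable) (simp add: distrib_right)
  ultimately have "(\<lambda>r. rogers_U q m r - rogers_V q (Suc m) r) sums (Q 0 - 0)"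
    using telescope_sums'[of Q 0] by simp
  moreover have "(\<lambda>r. rogers_U q m r - rogers_V q (Suc m) r) sums
      (suminf (rogers_U q m) - suminf (rogers_V q (Suc m)))"
    by (intro sums_diff summable_sums rogers_U_summable rogers_V_summable)
  ultimately have "Q 0 - 0 = suminf (rogers_U q m) - suminf (rogers_V q (Suc m))"
    by (rule sums_unique2)
  then show ?thesis
    by (simp add: Q_def)
qed


text \<open>The same splitting of factors, applied to the difference of the terms of the two series.  Together with the
preceding lemma it gives for \<open>rogers_V\<close> the recursion that the Rogers-Ramanujan sums satisfy.\<close>
lemma rogers_V_minus_U: "suminf (rogers_V q m) - suminf (rogers_U q m) = q ^ Suc m * suminf (rogers_U q (Suc m))"
proof -
  define Q where "Q r = (-1) ^ r * q ^ (5 * (r choose 2) + (2 * m + 3) * r) * (1 - q ^ r)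
     * (qpoch q q (m + r) / qpoch q q r)" for r
  have QSuc: "Q (Suc r) = - ((-1) ^ r * q ^ (5 * (r choose 2) + (2 * m + 6) * r)
      * q ^ (2 * m + 3 + 2 * r) * (qpoch q q (m + Suc r) / qpoch q q r))" for r
  proof -
    have e: "5 * (Suc r choose 2) + (2 * m + 3) * Suc r = 5 * (r choose 2) + (2 * m + 6) * r + (2 * m + 3 + 2 * r)"
      by (simp add: Suc_choose_two algebra_simps)
    have "(1 - q ^ Suc r) * (qpoch q q (m + Suc r) / qpoch q q (Suc r)) = qpoch q q (m + Suc r) / qpoch q q r"
      using one_minus_power_nonzero[OF q, of r] by (simp only: qpoch_qq_Suc[OF q]) simp
    then show ?thesis
      unfolding Q_def e power_add[of q "5 * (r choose 2) + (2 * m + 6) * r"] mult.assoc by simp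
  qed
  have P: "rogers_V q m r - rogers_U q m r = Q r + (-1) ^ r * q ^ (5 * (r choose 2) + (2 * m + 6) * r)
     * q ^ Suc m * (qpoch q q (m + Suc r) / qpoch q q r)" for r
  proof -
    define E where "E = q ^ (5 * (r choose 2) + (2 * m + 3) * r)"
    have E4: "q ^ (5 * (r choose 2) + (2 * m + 4) * r) = E * q ^ r"
      unfolding E_def power_add[symmetric] by (simp add: algebra_simps)
    have "(2 * m + 6) * r = (2 * m + 3) * r + 3 * r"
      using distrib_right[of "2 * m + 3" 3 r] by (simp only: add.assoc numeral_plus_numeral semiring_norm)
    then have E6: "q ^ (5 * (r choose 2) + (2 * m + 6) * r) = E * q ^ (3 * r)"
      unfolding E_def power_add[symmetric] by (simp only: add.assoc)
    have step: "qpoch q q (m + Suc r) = (1 - q ^ Suc m * q ^ r) * qpoch q q (m + r)"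
      using qpoch_qq_Suc[OF q, of "m + r"] by (simp add: power_add)
    have "(1 - q ^ (2 * m + 2 + 4 * r)) - q ^ r * (1 - q ^ (m + 1 + 2 * r))
        = (1 - q ^ r) + q ^ (3 * r) * q ^ Suc m * (1 - q ^ Suc m * q ^ r)"
    proof -
      have "q ^ (2 * m + 2 + 4 * r) = q ^ (3 * r) * q ^ Suc m * (q ^ Suc m * q ^ r)"
        unfolding power_add[symmetric] by (rule arg_cong[of _ _ "(^) q"]) simp
      moreover have "q ^ r * q ^ (m + 1 + 2 * r) = q ^ (3 * r) * q ^ Suc m"
        unfolding power_add[symmetric] by (rule arg_cong[of _ _ "(^) q"]) simp
      ultimately show ?thesis by (simp only: right_diff_distrib) simp
    qed
    note key = this
    have factor: "s * E * A * W - s * (E * c) * C * W = s * E * (A - c * C) * W" for s A W c C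
      by (simp add: algebra_simps)
    have "rogers_V q m r - rogers_U q m r = (-1) ^ r * E
        * ((1 - q ^ (2 * m + 2 + 4 * r)) - q ^ r * (1 - q ^ (m + 1 + 2 * r)))
        * (qpoch q q (m + r) / qpoch q q r)"
      unfolding rogers_U_def rogers_V_def E4 E_def[symmetric] by (rule factor)
    also have "\<dots> = Q r + (-1) ^ r * (E * q ^ (3 * r)) * q ^ Suc m
        * ((1 - q ^ Suc m * q ^ r) * qpoch q q (m + r) / qpoch q q r)"
    proof -
      have expand: "s * E * (A + x * y * C) * (W / w) = s * E * A * (W / w) + s * (E * x) * y * (C * W / w)"
        for s A x y C W w
        by (simp add: algebra_simps)
      show ?thesis
        unfolding key Q_def E_def[symmetric] by (rule expand)
    qed
    finally show ?thesis
      unfolding E6 step .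
  qed
  have "rogers_V q m r - rogers_U q m r - q ^ Suc m * rogers_U q (Suc m) r = Q r - Q (Suc r)" for r
  proof -
    have U: "rogers_U q (Suc m) r = (-1) ^ r * q ^ (5 * (r choose 2) + (2 * m + 6) * r)
        * (1 - q ^ (m + 2 + 2 * r)) * (qpoch q q (m + Suc r) / qpoch q q r)"
    proof -
      have "2 * Suc m + 4 = 2 * m + 6" "Suc m + 1 = m + 2" "Suc m + r = m + Suc r"
        by simp_all
      then show ?thesis unfolding rogers_U_def by (simp only:)
    qed
    have pow: "q ^ (2 * m + 3 + 2 * r) = q ^ Suc m * q ^ (m + 2 + 2 * r)"
      unfolding power_add[symmetric] by (rule arg_cong[of _ _ "(^) q"]) simp
    have collect: "A + s * F * x * W - x * (s * F * (1 - G) * W) = A - - (s * F * (x * G) * W)"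
      for A s F G W x :: complex
      by (simp add: algebra_simps)
    show ?thesis
      unfolding P QSuc U pow by (rule collect)
  qed
  moreover have "Q \<longlonglongrightarrow> 0"
    unfolding Q_def by (intro summable_LIMSEQ_zero rogers_series_summable) (simp add: distrib_right)
  ultimately have "(\<lambda>r. rogers_V q m r - rogers_U q m r - q ^ Suc m * rogers_U q (Suc m) r) sums (Q 0 - 0)"
    using telescope_sums'[of Q 0] by simp
  moreover have "(\<lambda>r. rogers_V q m r - rogers_U q m r - q ^ Suc m * rogers_U q (Suc m) r) sums
      (suminf (rogers_V q m) - suminf (rogers_U q m) - q ^ Suc m * suminf (rogers_U q (Suc m)))"
    by (intro sums_diff sums_mult summable_sums rogers_U_summable rogers_V_summable)
  ultimately have "Q 0 - 0 = suminf (rogers_V q m) - suminf (rogers_U q m) - q ^ Suc m * suminf (rogers_U q (Suc m))"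
    by (rule sums_unique2)
  then show ?thesis
    by (simp add: Q_def)
qed

lemma rogers_V_tendsto: "(\<lambda>m. suminf (rogers_V q m)) \<longlonglongrightarrow> qpoch_inf q q"
proof -
  obtain B where "B \<ge> 1 \<and> (\<forall>n. norm (qpoch q q n) \<le> B \<and> norm (1 / qpoch q q n) \<le> B)"
    using qpoch_qq_bounded[OF q] by (rule exE)
  then have B: "B \<ge> 1" "\<And>n. norm (qpoch q q n) \<le> B" "\<And>n. norm (1 / qpoch q q n) \<le> B"
    by simp_all
  have powers: "(\<lambda>m. q ^ m) \<longlonglongrightarrow> 0"
    by (rule LIMSEQ_power_zero[OF q])
  have lim: "(\<lambda>m. rogers_V q m r) \<longlonglongrightarrow> (if r = 0 then qpoch_inf q q else 0)" for r
  proof (cases "r = 0")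
    case True
    have "(\<lambda>m. (1 - q ^ m * q ^ m * q\<^sup>2) * qpoch q q m) \<longlonglongrightarrow> (1 - 0 * 0 * q\<^sup>2) * qpoch_inf q q"
      by (intro tendsto_mult tendsto_diff tendsto_const powers qpoch_tendsto q)
    moreover have "rogers_V q m 0 = (1 - q ^ m * q ^ m * q\<^sup>2) * qpoch q q m" for m
    proof -
      have "q ^ (2 * m + 2) = q ^ m * q ^ m * q\<^sup>2"
        unfolding power_add[symmetric] by (rule arg_cong[of _ _ "(^) q"]) simp
      then show ?thesis by (simp add: rogers_V_def)
    qed
    ultimately show ?thesis
      using True by simp
  next
    case False
    have m: "m \<le> 5 * (r choose 2) + (2 * m + 3) * r" for m
      using False by (cases r) auto
    have "(\<lambda>m. 2 * (B * B) * norm q ^ m) \<longlonglongrightarrow> 2 * (B * B) * 0"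
      by (intro tendsto_mult tendsto_const LIMSEQ_power_zero) (use q in simp)
    then have "(\<lambda>m. 2 * (B * B) * norm q ^ m) \<longlonglongrightarrow> 0"
      by simp
    moreover have "norm (rogers_V q m r) \<le> 2 * (B * B) * norm q ^ m" for m
      unfolding rogers_V_def by (intro rogers_term_bound B m)
    then have "\<forall>\<^sub>F m in sequentially. norm (rogers_V q m r) \<le> 2 * (B * B) * norm q ^ m"
      by (rule always_eventually[OF allI])
    ultimately have "(\<lambda>m. rogers_V q m r) \<longlonglongrightarrow> 0"
      by (rule Lim_null_comparison[rotated])
    then show ?thesis
      using False by simp
  qed
  have "norm (rogers_V q m r) \<le> 2 * (B * B) * norm q ^ r" for m r
    unfolding rogers_V_def by (intro rogers_term_bound B) (simp add: distrib_right)
  moreover have "summable (\<lambda>r. 2 * (B * B) * norm q ^ r)"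
    by (intro summable_mult summable_geometric) (use q in simp)
  ultimately have "(\<lambda>m. suminf (rogers_V q m)) \<longlonglongrightarrow> (\<Sum>r. if r = 0 then qpoch_inf q q else 0)"
    by (rule tannery[OF lim])
  moreover have "(\<Sum>r::nat. if r = 0 then qpoch_inf q q else 0) = qpoch_inf q q"
    using suminf_finite[of "{0}" "\<lambda>r::nat. if r = 0 then qpoch_inf q q else 0"] by simp
  ultimately show ?thesis
    by simp
qed

text \<open>Up to the constant \<open>(q;q)\<close>, both sides solve the same recursion with the same limit.\<close>
lemma rogers_V_eq_rr_sum: "suminf (rogers_V q m) = qpoch_inf q q * rr_sum q m"
proof -
  define d where "d m = suminf (rogers_V q m) - qpoch_inf q q * rr_sum q m" for m
  have "d m = d (Suc m) + q ^ Suc m * d (Suc (Suc m))" for m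
  proof -
    have "suminf (rogers_V q m) = suminf (rogers_V q (Suc m)) + q ^ Suc m * suminf (rogers_V q (Suc (Suc m)))"
      using rogers_V_minus_U[of m] unfolding rogers_U_eq_V by (simp add: algebra_simps)
    then show ?thesis
      unfolding d_def rr_sum_rec[of m] by (simp add: algebra_simps)
  qed
  moreover have "d \<longlonglongrightarrow> 0"
  proof -
    have "d \<longlonglongrightarrow> qpoch_inf q q - qpoch_inf q q * 1"
      unfolding d_def[abs_def] by (intro tendsto_diff tendsto_mult tendsto_const rogers_V_tendsto rr_sum_tendsto)
    then show ?thesis by simp
  qed
  ultimately have "d m = 0"
    by (rule backward_recursion_unique)
  then show ?thesis
    by (simp add: d_def)
qed

lemma norm_power5: "norm (q ^ 5) < 1"
  using q power_less_one_iff[of "norm q" 5] by (simp add: norm_power)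

text \<open>Sorting the factors \<open>1 - q^k\<close> by the residue of \<open>k\<close> modulo \<open>5\<close>.\<close>
lemma qpoch_inf_5_dissection:
  "qpoch_inf q q = qpoch_inf q (q ^ 5) * qpoch_inf (q ^ 2) (q ^ 5) * qpoch_inf (q ^ 3) (q ^ 5)
     * qpoch_inf (q ^ 4) (q ^ 5) * qpoch_inf (q ^ 5) (q ^ 5)"
proof (rule LIMSEQ_unique)
  have "qpoch q q (5 * n) = qpoch q (q ^ 5) n * qpoch (q ^ 2) (q ^ 5) n * qpoch (q ^ 3) (q ^ 5) n
     * qpoch (q ^ 4) (q ^ 5) n * qpoch (q ^ 5) (q ^ 5) n" for n
  proof (induction n)
    case (Suc n)
    have "5 * Suc n = Suc (Suc (Suc (Suc (Suc (5 * n)))))" by simp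
    then have "qpoch q q (5 * Suc n) = qpoch q q (5 * n) * (1 - q * (q ^ 5) ^ n) * (1 - q ^ 2 * (q ^ 5) ^ n)
       * (1 - q ^ 3 * (q ^ 5) ^ n) * (1 - q ^ 4 * (q ^ 5) ^ n) * (1 - q ^ 5 * (q ^ 5) ^ n)"
      by (simp only: qpoch_Suc power_mult[symmetric]) (simp add: eval_nat_numeral mult.assoc)
    then show ?case
      unfolding Suc qpoch_Suc by (simp only: mult_ac)
  qed simp
  moreover have "(\<lambda>n. qpoch q q (5 * n)) \<longlonglongrightarrow> qpoch_inf q q"
    using LIMSEQ_subseq_LIMSEQ[OF qpoch_tendsto[OF q], of "\<lambda>n. 5 * n"]
    by (simp add: strict_mono_def o_def)
  ultimately show "(\<lambda>n. qpoch q (q ^ 5) n * qpoch (q ^ 2) (q ^ 5) n * qpoch (q ^ 3) (q ^ 5) n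
     * qpoch (q ^ 4) (q ^ 5) n * qpoch (q ^ 5) (q ^ 5) n) \<longlonglongrightarrow> qpoch_inf q q"
    by simp
  show "(\<lambda>n. qpoch q (q ^ 5) n * qpoch (q ^ 2) (q ^ 5) n * qpoch (q ^ 3) (q ^ 5) n
     * qpoch (q ^ 4) (q ^ 5) n * qpoch (q ^ 5) (q ^ 5) n)
     \<longlonglongrightarrow> qpoch_inf q (q ^ 5) * qpoch_inf (q ^ 2) (q ^ 5) * qpoch_inf (q ^ 3) (q ^ 5)
     * qpoch_inf (q ^ 4) (q ^ 5) * qpoch_inf (q ^ 5) (q ^ 5)"
    by (intro tendsto_mult qpoch_tendsto norm_power5)
qed

text \<open>At \<open>m = 0\<close> the quotient \<open>(q;q)\<^sub>m\<^sub>+\<^sub>r / (q;q)\<^sub>r\<close> disappears, so both auxiliary series are theta series with base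
\<open>q^5\<close>.  Jacobi's triple product evaluates them, and the factors common with \<open>(q;q)\<close> cancel.\<close>
lemma rogers_ramanujan:
  assumes "q \<noteq> 0"
  shows "rr_sum q 0 = 1 / (qpoch_inf q (q ^ 5) * qpoch_inf (q ^ 4) (q ^ 5))"
    and "rr_sum q 1 = 1 / (qpoch_inf (q ^ 2) (q ^ 5) * qpoch_inf (q ^ 3) (q ^ 5))"
proof -
  let ?Pi = "\<lambda>i. qpoch_inf (q ^ i) (q ^ 5)"
  have nz: "?Pi 1 \<noteq> 0" "?Pi 2 \<noteq> 0" "?Pi 3 \<noteq> 0" "?Pi 4 \<noteq> 0" "?Pi 5 \<noteq> 0"
    by (rule qpoch_inf_power_nonzero[OF q], simp, simp)+
  have five: "qpoch_inf q q = ?Pi 1 * ?Pi 2 * ?Pi 3 * ?Pi 4 * ?Pi 5"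
    using qpoch_inf_5_dissection by simp
  have "q ^ 3 * q ^ 2 = q ^ 5" "q ^ 4 * q ^ 1 = q ^ 5" "q ^ 5 \<noteq> 0"
    using assms unfolding power_add[symmetric] by simp_all
  note jtp = jacobi_triple_product[OF norm_power5 this(1) this(3)] jacobi_triple_product[OF norm_power5 this(2) this(3)]
  have "rogers_V q 0 r = (-1) ^ r * ((q ^ 5) ^ (r choose 2) * (q ^ 3) ^ r - (q ^ 5) ^ (Suc r choose 2) * (q ^ 2) ^ Suc r)" for r
  proof -
    have "5 * (Suc r choose 2) + 2 * Suc r = 5 * (r choose 2) + 3 * r + (2 + 4 * r)"
      by (simp add: Suc_choose_two)
    then have "(q ^ 5) ^ (Suc r choose 2) * (q ^ 2) ^ Suc r = q ^ (5 * (r choose 2) + 3 * r) * q ^ (2 + 4 * r)"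
      by (simp only: power_mult[symmetric] power_add[symmetric])
    moreover have "(q ^ 5) ^ (r choose 2) * (q ^ 3) ^ r = q ^ (5 * (r choose 2) + 3 * r)"
      by (simp only: power_mult[symmetric] power_add[symmetric])
    ultimately show ?thesis
      using qpoch_qq_nonzero[OF q, of r] by (simp add: rogers_V_def right_diff_distrib)
  qed
  then have "suminf (rogers_V q 0) = ?Pi 3 * ?Pi 2 * ?Pi 5"
    by (rule trans[OF suminf_cong sums_unique[OF jtp(1), symmetric]])
  then show "rr_sum q 0 = 1 / (qpoch_inf q (q ^ 5) * qpoch_inf (q ^ 4) (q ^ 5))"
    using nz unfolding rogers_V_eq_rr_sum five by (simp add: field_simps)
  have "rogers_U q 0 r = (-1) ^ r * ((q ^ 5) ^ (r choose 2) * (q ^ 4) ^ r - (q ^ 5) ^ (Suc r choose 2) * (q ^ 1) ^ Suc r)" for r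
  proof -
    have "5 * (Suc r choose 2) + 1 * Suc r = 5 * (r choose 2) + 4 * r + (1 + 2 * r)"
      by (simp add: Suc_choose_two)
    then have "(q ^ 5) ^ (Suc r choose 2) * (q ^ 1) ^ Suc r = q ^ (5 * (r choose 2) + 4 * r) * q ^ (1 + 2 * r)"
      by (simp only: power_mult[symmetric] power_add[symmetric])
    moreover have "(q ^ 5) ^ (r choose 2) * (q ^ 4) ^ r = q ^ (5 * (r choose 2) + 4 * r)"
      by (simp only: power_mult[symmetric] power_add[symmetric])
    ultimately show ?thesis
      using qpoch_qq_nonzero[OF q, of r] by (auto simp: rogers_U_def right_diff_distrib)
  qed
  then have "suminf (rogers_U q 0) = ?Pi 4 * ?Pi 1 * ?Pi 5"
    by (rule trans[OF suminf_cong sums_unique[OF jtp(2), symmetric]])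
  then show "rr_sum q 1 = 1 / (qpoch_inf (q ^ 2) (q ^ 5) * qpoch_inf (q ^ 3) (q ^ 5))"
    using nz unfolding rogers_U_eq_V rogers_V_eq_rr_sum five by (simp add: field_simps)
qed

end

section \<open>Schur's polynomials and the shifted Rogers-Ramanujan sums\<close>

text \<open>The common shape of Schur's two families: \<open>c = 0\<close> gives \<open>b\<^sub>m\<close>, and \<open>c = 1\<close> gives \<open>a\<^sub>m\<close>
for \<open>m > 0\<close>.\<close>
definition schur_sum :: "nat \<Rightarrow> complex \<Rightarrow> nat \<Rightarrow> complex" where
  "schur_sum c q m = (\<Sum>j. q ^ (j\<^sup>2 + c * j) * qbinom q (int m - int j - 1 - int c) (int j))"

lemma schur_sum_finite:
  assumes "m \<le> N"
  shows "schur_sum c q m = (\<Sum>j\<le>N. q ^ (j\<^sup>2 + c * j) * qbinom q (int m - int j - 1 - int c) (int j))"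
  unfolding schur_sum_def by (rule suminf_finite) (use assms in \<open>auto simp: qbinom_def\<close>)

lemma schur_a_eq_schur_sum: "m > 0 \<Longrightarrow> schur_a m q = schur_sum 1 q m"
  by (simp add: schur_a_def schur_sum_def)

lemma schur_b_eq_schur_sum: "schur_b m q = schur_sum 0 q m"
  by (simp add: schur_b_def schur_sum_def)

context
  fixes q :: complex
  assumes q: "norm q < 1"
begin

text \<open>The rule fails only at \<open>n = k = 0\<close>, where the left side is \<open>1\<close> and both terms on the right vanish.\<close>
lemma qbinom_pascal:
  assumes "n \<noteq> 0 \<or> k \<noteq> 0"
  shows "qbinom q n k = qbinom q (n - 1) k + q ^ nat (n - k) * qbinom q (n - 1) (k - 1)"
proof -
  note nz = qpoch_qq_nonzero[OF q]
  consider "k < 0 \<or> k > n" | "k = 0" "n > 0" | "k = n" "n > 0" | "0 < k" "k < n"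
    using assms by linarith
  then show ?thesis
  proof cases
    case 4
    define K J where "K = nat (k - 1)" and "J = nat (n - k - 1)"
    have kn: "nat k = Suc K" "nat n = Suc (Suc (K + J))" "nat (n - 1) = Suc (K + J)"
      "nat (n - k) = Suc J" "nat (n - 1 - k) = J" "nat (k - 1) = K" "nat (n - 1 - (k - 1)) = Suc J"
      using 4 by (auto simp: K_def J_def)
    let ?P = "qpoch q q"
    have a: "1 - q ^ Suc (Suc (K + J)) = (1 - q ^ Suc J) + q ^ Suc J * (1 - q ^ Suc K)"
    proof -
      have "q ^ Suc (Suc (K + J)) = q ^ Suc J * q ^ Suc K"
        unfolding power_add[symmetric] by (rule arg_cong[of _ _ "(^) q"]) simp
      then show ?thesis by (simp only: right_diff_distrib) simp
    qed
    have frac: "((x + y * w) * A) / (w * B * (x * C)) = A / (w * B * C) + y * (A / (B * (x * C)))"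
      if "x \<noteq> 0" "w \<noteq> 0" "B \<noteq> 0" "C \<noteq> 0" for x y w A B C :: complex
      using that by (simp add: field_simps)
    have "?P (Suc (Suc (K + J))) / (?P (Suc K) * ?P (Suc J))
      = ?P (Suc (K + J)) / (?P (Suc K) * ?P J) + q ^ Suc J * (?P (Suc (K + J)) / (?P K * ?P (Suc J)))"
      unfolding qpoch_qq_Suc[OF q, of "Suc (K + J)"] qpoch_qq_Suc[OF q, of K] qpoch_qq_Suc[OF q, of J] a
      by (rule frac) (use nz one_minus_power_nonzero[OF q] in \<open>simp_all del: power_Suc\<close>)
    then show ?thesis
      using 4 by (simp add: qbinom_def kn del: power_Suc)
  qed (use nz in \<open>auto simp: qbinom_def\<close>)
qed

text \<open>The \<open>q\<close>-Pascal rule termwise.  In the second part, shifting the index turns the exponent into \<open>m\<close> plus the old one.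
The excluded value of \<open>c\<close> is the one for which the exceptional case of the Pascal rule occurs in the term \<open>j = 0\<close>.\<close>
lemma schur_sum_rec:
  assumes "c \<noteq> Suc m"
  shows "schur_sum c q (Suc (Suc m)) = schur_sum c q (Suc m) + q ^ m * schur_sum c q m"
proof -
  let ?t = "\<lambda>m j. q ^ (j\<^sup>2 + c * j) * qbinom q (int m - int j - 1 - int c) (int j)"
  let ?r = "\<lambda>j. q ^ (j\<^sup>2 + c * j) * (q ^ nat (int m + 1 - int c - 2 * int j)
              * qbinom q (int m - int c - int j) (int j - 1))"
  have "?t (Suc (Suc m)) j = ?t (Suc m) j + ?r j" for j
  proof -
    have "int m + 1 - int c - int j \<noteq> 0 \<or> int j \<noteq> 0"
      using assms by linarith
    from qbinom_pascal[OF this]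
    have "qbinom q (int m + 1 - int c - int j) (int j)
        = qbinom q (int m - int c - int j) (int j)
          + q ^ nat (int m + 1 - int c - 2 * int j) * qbinom q (int m - int c - int j) (int j - 1)"
      by (simp add: algebra_simps)
    then show ?thesis
      by (simp add: algebra_simps)
  qed
  moreover have "?r (Suc i) = q ^ m * ?t m i" for i
  proof (cases "2 * int i \<le> int m - 1 - int c")
    case True
    then have "(Suc i)\<^sup>2 + c * Suc i + nat (int m + 1 - int c - 2 * int (Suc i)) = m + (i\<^sup>2 + c * i)"
      by (simp add: power2_eq_square nat_diff_distrib algebra_simps)
    then have "q ^ ((Suc i)\<^sup>2 + c * Suc i) * q ^ nat (int m + 1 - int c - 2 * int (Suc i))
        = q ^ m * q ^ (i\<^sup>2 + c * i)"
      by (simp only: power_add[symmetric])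
    moreover have "qbinom q (int m - int c - int (Suc i)) (int (Suc i) - 1)
        = qbinom q (int m - int i - 1 - int c) (int i)"
      by (rule arg_cong2[of _ _ _ _ "qbinom q"]) simp_all
    ultimately show ?thesis
      by (simp only: mult.assoc[symmetric])
  next
    case False
    then show ?thesis
      by (simp add: qbinom_def)
  qed
  moreover have "?r 0 = 0"
    by (simp add: qbinom_def)
  ultimately have "(\<Sum>j\<le>Suc (Suc m). ?t (Suc (Suc m)) j)
      = (\<Sum>j\<le>Suc (Suc m). ?t (Suc m) j) + (\<Sum>i\<le>Suc m. q ^ m * ?t m i)"
    by (simp only: sum.distrib sum.atMost_Suc_shift[of ?r] add_0_left)
  then show ?thesis
    using schur_sum_finite[of "Suc (Suc m)" "Suc (Suc m)" c q] schur_sum_finite[of "Suc m" "Suc (Suc m)" c q]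
      schur_sum_finite[of m "Suc m" c q]
    by (simp only: sum_distrib_left)
qed

lemma schur_initial:
  "schur_a 0 q = 1" "schur_a 1 q = 0" "schur_b 0 q = 0" "schur_b 1 q = 1"
  by (simp_all add: schur_a_def schur_b_eq_schur_sum schur_a_eq_schur_sum
        schur_sum_finite[of 0 0] schur_sum_finite[of "Suc 0" "Suc 0"] qbinom_def)

text \<open>For \<open>m = 0\<close> the recursion rests on the convention \<open>a\<^sub>0 = 1\<close>, so that \<open>a\<^sub>2 = a\<^sub>1 + a\<^sub>0\<close>.\<close>
lemma schur_a_rec: "schur_a (Suc (Suc m)) q = schur_a (Suc m) q + q ^ m * schur_a m q"
proof (cases "m = 0")
  case True
  have "schur_a 2 q = 1"
    using schur_sum_finite[of 2 2 1 q] by (simp add: schur_a_eq_schur_sum qbinom_def numeral_2_eq_2)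
  then show ?thesis
    using True schur_initial by (simp add: numeral_2_eq_2)
next
  case False
  then show ?thesis
    using schur_sum_rec[of 1 m] by (simp add: schur_a_eq_schur_sum)
qed

lemma schur_b_rec: "schur_b (Suc (Suc m)) q = schur_b (Suc m) q + q ^ m * schur_b m q"
  using schur_sum_rec[of 0 m] by (simp add: schur_b_eq_schur_sum)

text \<open>Two neighbouring absolute values are at most the maximum of the first two times a partial product of \<open>\<Prod>(1 + t^k)\<close>, \<open>t = norm q\<close>.\<close>
lemma forward_recursion_bounded:
  fixes a :: "nat \<Rightarrow> complex"
  assumes rec: "\<And>m. a (Suc (Suc m)) = a (Suc m) + q ^ m * a m"
  shows "Bseq a"
proof -
  have "\<exists>P::nat \<Rightarrow> real. (\<forall>m. P m \<ge> 1 \<and> P (Suc m) = P m * (1 + norm q ^ m)) \<and> Bseq P"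
    by (rule bounded_partial_products) (use q in auto)
  then obtain P :: "nat \<Rightarrow> real" where "(\<forall>m. P m \<ge> 1 \<and> P (Suc m) = P m * (1 + norm q ^ m)) \<and> Bseq P"
    by (rule exE)
  then have P: "\<And>m. P m \<ge> 1" "\<And>m. P (Suc m) = P m * (1 + norm q ^ m)" "Bseq P"
    by simp_all
  obtain K where K: "\<And>m. norm (P m) \<le> K"
    using P(3) by (meson BseqE)
  define E where "E = max (norm (a 0)) (norm (a 1))"
  have E0: "0 \<le> E" by (simp add: E_def le_max_iff_disj)
  have "norm (a m) \<le> P m * E \<and> norm (a (Suc m)) \<le> P m * E" for m
  proof (induction m)
    case 0
    have "1 * E \<le> P 0 * E"
      by (rule mult_right_mono[OF P(1) E0])
    moreover have "norm (a 0) \<le> E" "norm (a (Suc 0)) \<le> E"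
      by (simp_all add: E_def)
    ultimately show ?case
      by linarith
  next
    case (Suc m)
    have PE: "0 \<le> norm q ^ m * (P m * E)"
      using P(1)[of m] E0 by (intro mult_nonneg_nonneg) auto
    have "norm (a (Suc (Suc m))) \<le> norm (a (Suc m)) + norm q ^ m * norm (a m)"
      using norm_triangle_ineq[of "a (Suc m)" "q ^ m * a m"]
      unfolding rec[of m, symmetric] norm_mult norm_power .
    also have "norm q ^ m * norm (a m) \<le> norm q ^ m * (P m * E)"
      by (rule mult_left_mono) (use Suc in auto)
    finally have "norm (a (Suc (Suc m))) \<le> P m * E + norm q ^ m * (P m * E)"
      using Suc by linarith
    moreover have "P (Suc m) * E = P m * E + norm q ^ m * (P m * E)"
      unfolding P(2) by (simp add: algebra_simps)
    ultimately show ?case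
      using Suc PE by linarith
  qed
  moreover have "P m * E \<le> K * E" for m
    using mult_right_mono[OF K[of m] E0] P(1)[of m] by simp
  ultimately have "norm (a m) \<le> K * E" for m
    by (meson order_trans)
  then show ?thesis
    by (rule BseqI')
qed

text \<open>Multiplied by \<open>(-1)^m q^(m choose 2)\<close>, the Rogers-Ramanujan sums satisfy Schur's recursion.  The two
Rogers-Ramanujan identities are the initial values.\<close>
lemma rr_sum_schur:
  assumes "q \<noteq> 0"
  shows "(-1) ^ m * q ^ (m choose 2) * rr_sum q m
    = schur_a m q / (qpoch_inf q (q ^ 5) * qpoch_inf (q ^ 4) (q ^ 5))
      - schur_b m q / (qpoch_inf (q ^ 2) (q ^ 5) * qpoch_inf (q ^ 3) (q ^ 5))"
    (is "?\<sigma> m = ?\<tau> m")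
proof (induction m rule: induct_nat_012)
  case 0
  show ?case
    using rogers_ramanujan[OF q assms] schur_initial by simp
next
  case 1
  show ?case
    using rogers_ramanujan[OF q assms] schur_initial by (simp add: Suc_choose_two)
next
  case (ge2 m)
  have "?\<sigma> (Suc (Suc m)) = q ^ m * ?\<sigma> m + ?\<sigma> (Suc m)"
  proof -
    have "rr_sum q m - rr_sum q (Suc m) = q ^ Suc m * rr_sum q (Suc (Suc m))"
      using rr_sum_rec[OF q, of m] by simp
    moreover have "(Suc (Suc m) choose 2) = (m choose 2) + m + Suc m"
      by (simp add: Suc_choose_two)
    ultimately have "?\<sigma> (Suc (Suc m)) = (-1) ^ m * (q ^ (m choose 2) * q ^ m) * (rr_sum q m - rr_sum q (Suc m))"
      by (simp only: power_add mult.assoc) simp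
    then show ?thesis
      by (simp add: Suc_choose_two power_add algebra_simps)
  qed
  then show ?case
    unfolding ge2 schur_a_rec schur_b_rec by (simp add: algebra_simps add_divide_distrib)
qed

end

section \<open>The triple series\<close>

lemma summable_on_times:
  fixes f :: "'a \<Rightarrow> real" and g :: "'b \<Rightarrow> real"
  assumes "f summable_on A" "g summable_on B" "\<And>x. f x \<ge> 0" "\<And>y. g y \<ge> 0"
  shows "(\<lambda>(x, y). f x * g y) summable_on (A \<times> B)"
proof (rule summable_on_SigmaI[where g = "\<lambda>x. f x * infsum g B"])
  show "((\<lambda>y. case (x, y) of (x, y) \<Rightarrow> f x * g y) has_sum f x * infsum g B) B" for x
    using assms(2) by (simp add: has_sum_cmult_right)
  show "(\<lambda>x. f x * infsum g B) summable_on A"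
    by (rule summable_on_cmult_left) (use assms in auto)
qed (use assms in auto)

text \<open>The index \<open>(k, m, j)\<close> records the three expansions of the left side of the transformation: \<open>k\<close> belongs to the finite product
\<open>(-q^(l+1)/z;q)\<^sub>n\<close>, \<open>m = n - k\<close> completes the index of the outer series, and \<open>j\<close> belongs to Euler's expansion of
\<open>(z q^n;q)\<close>.\<close>
definition triple_term :: "complex \<Rightarrow> complex \<Rightarrow> nat \<Rightarrow> nat \<times> nat \<times> nat \<Rightarrow> complex" where
  "triple_term q z l = (\<lambda>(k, m, j). q ^ (k\<^sup>2 + l * k) / qpoch q q k
     * ((-1) ^ j * q ^ (k * (m + j) + ((m + j) choose 2)) * z ^ (m + j) / (qpoch q q m * qpoch q q j)))"

context
  fixes q :: complex
  assumes q: "norm q < 1"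
begin

lemma euler_term_summable: "summable (\<lambda>k. norm ((-1) ^ k * q ^ (k choose 2) * a ^ k / qpoch q q k))"
proof -
  obtain B where "B \<ge> 1 \<and> (\<forall>n. norm (qpoch q q n) \<le> B \<and> norm (1 / qpoch q q n) \<le> B)"
    using qpoch_qq_bounded[OF q] by (rule exE)
  then have B: "\<And>n. norm (1 / qpoch q q n) \<le> B"
    by simp_all
  have "summable (\<lambda>k. norm q ^ (k choose 2) * norm a ^ k * B)"
    by (intro summable_mult2 summable_theta) (use q in auto)
  then show ?thesis
  proof (rule summable_comparison_test'[of _ 0])
    fix k
    have "norm q ^ (k choose 2) * norm a ^ k * norm (1 / qpoch q q k) \<le> norm q ^ (k choose 2) * norm a ^ k * B"
      by (intro mult_left_mono B) simp
    then show "norm (norm ((-1) ^ k * q ^ (k choose 2) * a ^ k / qpoch q q k)) \<le> norm q ^ (k choose 2) * norm a ^ k * B"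
      by (simp add: norm_mult norm_divide norm_power)
  qed
qed

lemma euler_has_sum:
  "((\<lambda>k. (-1) ^ k * q ^ (k choose 2) * a ^ k / qpoch q q k) has_sum qpoch_inf a q) UNIV"
  by (rule norm_summable_imp_has_sum[OF euler_term_summable euler_expansion[OF q]])

lemma rr_sum_has_sum: "((\<lambda>k. q ^ (k\<^sup>2 + m * k) / qpoch q q k) has_sum rr_sum q m) UNIV"
  unfolding rr_sum_def
  by (rule norm_summable_imp_has_sum[OF rr_sum_summable[OF q] summable_sums])
     (rule summable_norm_cancel[OF rr_sum_summable[OF q]])


text \<open>After dropping the mixed exponents \<open>k (m + j)\<close> and \<open>m j\<close>, the absolute values factor into three summable
sequences.\<close>
lemma triple_term_summable: "triple_term q z l summable_on UNIV"
proof -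
  define A where "A k = norm (q ^ (k\<^sup>2 + l * k) / qpoch q q k)" for k
  define D where "D m = norm ((-1) ^ m * q ^ (m choose 2) * z ^ m / qpoch q q m)" for m
  have A: "A summable_on UNIV" and D: "D summable_on UNIV"
    unfolding A_def D_def
    by (intro summable_nonneg_imp_summable_on rr_sum_summable[OF q] euler_term_summable; simp)+
  have DD: "(\<lambda>(m, j). D m * D j) summable_on UNIV \<times> UNIV"
    by (rule summable_on_times[OF D D]) (simp_all add: D_def)
  have "(\<lambda>(k, p). A k * (\<lambda>(m, j). D m * D j) p) summable_on UNIV \<times> (UNIV \<times> UNIV)"
    by (rule summable_on_times[OF A DD]) (auto simp: A_def D_def split: prod.splits)
  then have "(\<lambda>(k, p). A k * (\<lambda>(m, j). D m * D j) p) summable_on UNIV"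
    by simp
  then have "(\<lambda>x. norm (triple_term q z l x)) summable_on UNIV"
  proof (rule Infinite_Sum.abs_summable_on_comparison_test')
    fix x :: "nat \<times> nat \<times> nat"
    obtain k m j where x: "x = (k, m, j)"
      by (cases x)
    have "norm (triple_term q z l x) = A k * (norm q ^ (k * (m + j) + ((m + j) choose 2)) * norm z ^ (m + j)
        / (norm (qpoch q q m) * norm (qpoch q q j)))"
      by (simp add: x triple_term_def A_def norm_mult norm_divide norm_power)
    also have "\<dots> \<le> A k * (norm q ^ ((m choose 2) + (j choose 2)) * norm z ^ (m + j)
        / (norm (qpoch q q m) * norm (qpoch q q j)))"
      using q by (intro mult_left_mono divide_right_mono mult_right_mono power_decreasing)
        (auto simp: A_def add_choose_two)
    also have "\<dots> = (case x of (k, p) \<Rightarrow> A k * (case p of (m, j) \<Rightarrow> D m * D j))"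
      by (simp add: x D_def norm_mult norm_divide norm_power power_add)
    finally show "norm (triple_term q z l x) \<le> (case x of (k, p) \<Rightarrow> A k * (case p of (m, j) \<Rightarrow> D m * D j))" .
  qed
  then show ?thesis
    by (rule abs_summable_summable)
qed

text \<open>For fixed \<open>n = k + m\<close>, the sum over \<open>j\<close> is Euler's expansion of \<open>(z q^n;q)\<close>, and then the sum over
\<open>k\<close> is the \<open>q\<close>-binomial theorem.\<close>
lemma triple_sum_by_k_plus_m:
  assumes "z \<noteq> 0"
  shows "((\<lambda>n. z ^ n * q ^ (n choose 2) * qpoch (- (q ^ (l + 1)) / z) q n / qpoch q q n * qpoch_inf (z * q ^ n) q)
     has_sum infsum (triple_term q z l) UNIV) UNIV"
proof -
  let ?P = "qpoch q q" and ?a = "- (q ^ (l + 1)) / z"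
  define c where "c n k = q ^ (k\<^sup>2 + l * k) / ?P k * (q ^ (k * (n - k) + ((n - k) choose 2)) * z ^ (n - k) / ?P (n - k))"
    for n k
  define F where "F = (\<lambda>((n, k), j). triple_term q z l (k, n - k, j))"
  define G where "G = (\<lambda>(n, k). c n k * qpoch_inf (z * q ^ n) q)"
  have "(triple_term q z l has_sum infsum (triple_term q z l) UNIV) UNIV"
    by (rule has_sum_infsum[OF triple_term_summable])
  then have "(F has_sum infsum (triple_term q z l) UNIV)
      (SIGMA p : (SIGMA n : UNIV. {..n}). UNIV)"
    by (rule iffD2[OF has_sum_reindex_bij_witness[of _ "\<lambda>(k, m, j). ((k + m, k), j)"
          "\<lambda>((n, k), j). (k, n - k, j)" UNIV "triple_term q z l" F], rotated -1])
       (auto simp: F_def)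
  then have "(G has_sum infsum (triple_term q z l) UNIV)
      (SIGMA n : UNIV. {..n})"
  proof (rule has_sum_SigmaD)
    fix p :: "nat \<times> nat"
    assume "p \<in> (SIGMA n : UNIV. {..n})"
    then obtain n k where p: "p = (n, k)" and "k \<le> n"
      by auto
    then obtain m where n: "n = k + m"
      using le_Suc_ex by blast
    have "triple_term q z l (k, m, j) = c n k * ((-1) ^ j * q ^ (j choose 2) * (z * q ^ n) ^ j / ?P j)" for j
      unfolding n by (simp add: triple_term_def c_def add_choose_two power_add power_mult_distrib
          power_mult[symmetric] distrib_left distrib_right mult_ac)
    moreover have "((\<lambda>j. c n k * ((-1) ^ j * q ^ (j choose 2) * (z * q ^ n) ^ j / ?P j))
        has_sum c n k * qpoch_inf (z * q ^ n) q) UNIV"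
      by (rule has_sum_cmult_right[OF euler_has_sum])
    ultimately show "((\<lambda>j. F (p, j)) has_sum G p) UNIV"
      by (simp add: F_def G_def p n)
  qed
  then have "((\<lambda>n. \<Sum>k\<le>n. c n k * qpoch_inf (z * q ^ n) q) has_sum infsum (triple_term q z l) UNIV) UNIV"
    by (rule has_sum_SigmaD) (simp add: G_def)
  moreover have "(\<Sum>k\<le>n. c n k * qpoch_inf (z * q ^ n) q)
      = z ^ n * q ^ (n choose 2) * qpoch ?a q n / ?P n * qpoch_inf (z * q ^ n) q" for n
  proof -
    have "c n k = z ^ n * q ^ (n choose 2) * ((-1) ^ k * q ^ (k choose 2) * ?a ^ k / (?P k * ?P (n - k)))"
      if kn: "k \<le> n" for k
    proof -
      obtain m where n: "n = k + m"
        using le_Suc_ex[OF kn] by blast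
      have "k\<^sup>2 = 2 * (k choose 2) + k"
        by (induction k) (simp_all add: Suc_choose_two power2_eq_square)
      then have exps: "q ^ (k\<^sup>2 + l * k) * q ^ (k * m + (m choose 2)) = q ^ (n choose 2) * (q ^ (k choose 2) * (q ^ (l + 1)) ^ k)"
        unfolding n power_mult[symmetric] power_add[symmetric] add_choose_two
        by (intro arg_cong[of _ _ "(^) q"]) (simp add: algebra_simps)
      have signs: "(-1) ^ k * ?a ^ k = (q ^ (l + 1)) ^ k / z ^ k"
        unfolding power_mult_distrib[symmetric] power_divide[symmetric] by simp
      have nk: "n - k = m"
        by (simp add: n)
      have zn: "z ^ n = z ^ k * z ^ m"
        by (simp add: n power_add)
      have regroup: "a / P * (b * w / R) = x * w * e * (s * f * h / (P * R))"
        if "a * b = e * (f * g)" "s * h = g / x" "x \<noteq> 0" for a b e f g h s x w P R :: complex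
      proof -
        have "x * w * e * (s * f * h / (P * R)) = w * (e * f) * (x * (s * h)) / (P * R)"
          by (simp add: mult_ac)
        also have "x * (s * h) = g"
          using that(2,3) by simp
        also have "w * (e * f) * g = a * b * w"
          unfolding that(1) by (simp only: mult_ac)
        finally show ?thesis
          by (simp only: times_divide_times_eq mult.assoc)
      qed
      show ?thesis
        unfolding c_def nk zn by (rule regroup[OF exps signs]) (use \<open>z \<noteq> 0\<close> in simp)
    qed
    then have "(\<Sum>k\<le>n. c n k) = z ^ n * q ^ (n choose 2) * (qpoch ?a q n / ?P n)"
      unfolding q_binomial_theorem[OF q, symmetric] sum_distrib_left by (intro sum.cong) auto
    then show ?thesis
      by (simp add: sum_distrib_right[symmetric])
  qed
  ultimately show ?thesis
    by (simp only:)
qed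

text \<open>For fixed \<open>N = m + j\<close> the general term depends on \<open>j\<close> only through the sign and the two denominators, so the sum over
\<open>k\<close> is a Rogers-Ramanujan sum and the sum over \<open>j\<close> is an alternating sum of Gaussian binomials.\<close>
lemma triple_sum_by_m_plus_j:
  "((\<lambda>N. q ^ (N choose 2) * z ^ N * (\<Sum>j\<le>N. (-1) ^ j / (qpoch q q j * qpoch q q (N - j))) * rr_sum q (N + l))
     has_sum infsum (triple_term q z l) UNIV) UNIV"
proof -
  let ?P = "qpoch q q"
  define c where "c N j = q ^ (N choose 2) * z ^ N * ((-1) ^ j / (?P j * ?P (N - j)))" for N j
  define F where "F = (\<lambda>((N, j), k). triple_term q z l (k, N - j, j))"
  define G where "G = (\<lambda>(N, j). c N j * rr_sum q (N + l))"
  have "(triple_term q z l has_sum infsum (triple_term q z l) UNIV) UNIV"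
    by (rule has_sum_infsum[OF triple_term_summable])
  then have "(F has_sum infsum (triple_term q z l) UNIV)
      (SIGMA p : (SIGMA N : UNIV. {..N}). UNIV)"
    by (rule iffD2[OF has_sum_reindex_bij_witness[of _ "\<lambda>(k, m, j). ((m + j, j), k)"
          "\<lambda>((N, j), k). (k, N - j, j)" UNIV "triple_term q z l" F], rotated -1])
       (auto simp: F_def)
  then have "(G has_sum infsum (triple_term q z l) UNIV)
      (SIGMA N : UNIV. {..N})"
  proof (rule has_sum_SigmaD)
    fix p :: "nat \<times> nat"
    assume "p \<in> (SIGMA N : UNIV. {..N})"
    then obtain N j where p: "p = (N, j)" and "j \<le> N"
      by auto
    then obtain m where N: "N = m + j"
      by (metis le_add_diff_inverse2)
    have "triple_term q z l (k, m, j) = c N j * (q ^ (k\<^sup>2 + (N + l) * k) / ?P k)" for k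
      unfolding N by (simp add: triple_term_def c_def power_add distrib_left distrib_right mult.commute)
    moreover have "((\<lambda>k. c N j * (q ^ (k\<^sup>2 + (N + l) * k) / ?P k)) has_sum c N j * rr_sum q (N + l)) UNIV"
      by (rule has_sum_cmult_right[OF rr_sum_has_sum])
    ultimately show "((\<lambda>k. F (p, k)) has_sum G p) UNIV"
      by (simp add: F_def G_def p N)
  qed
  then have "((\<lambda>N. \<Sum>j\<le>N. c N j * rr_sum q (N + l)) has_sum infsum (triple_term q z l) UNIV) UNIV"
    by (rule has_sum_SigmaD) (simp add: G_def)
  then show ?thesis
    by (simp add: c_def sum_distrib_left sum_distrib_right)
qed

text \<open>Multiplication by \<open>(z;q)\<close> turns the denominators \<open>(z;q)\<^sub>n\<close> into \<open>(z q^n;q)\<close>.\<close>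
lemma phi11_eq_triple_sum:
  assumes "z \<noteq> 0" and z: "\<And>k. z * q ^ k \<noteq> 1"
  shows "qpoch_inf z q * phi11 (- (q ^ (l + 1)) / z) z q (- z) = infsum (triple_term q z l) UNIV"
proof -
  let ?a = "- (q ^ (l + 1)) / z"
  define f where "f n = qpoch ?a q n / (qpoch q q n * qpoch z q n) * (-1) ^ n * q ^ (n * (n - 1) div 2) * (- z) ^ n" for n
  have "qpoch_inf z q * f n
      = z ^ n * q ^ (n choose 2) * qpoch ?a q n / qpoch q q n * qpoch_inf (z * q ^ n) q" for n
  proof -
    have nz: "qpoch z q n \<noteq> 0"
      using z by (auto simp: qpoch_def)
    have "qpoch_inf z q = qpoch z q n * qpoch_inf (z * q ^ n) q"
      by (rule qpoch_inf_split[OF q])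
    moreover have "(-1) ^ n * (- z) ^ n = z ^ n"
      by (simp add: power_mult_distrib[symmetric])
    moreover have "f n = qpoch ?a q n / (qpoch q q n * qpoch z q n) * q ^ (n choose 2) * ((-1) ^ n * (- z) ^ n)"
      by (simp add: f_def choose_two)
    ultimately show ?thesis
      using nz by (simp only:) simp
  qed
  then have "(\<lambda>n. qpoch_inf z q * f n) sums infsum (triple_term q z l) UNIV"
    using has_sum_imp_sums[OF triple_sum_by_k_plus_m[OF \<open>z \<noteq> 0\<close>]] by simp
  moreover have "qpoch_inf z q \<noteq> 0"
    by (rule qpoch_inf_nonzero[OF q z])
  ultimately have "f sums (infsum (triple_term q z l) UNIV / qpoch_inf z q)"
    using sums_mult_iff[of "qpoch_inf z q" f "infsum (triple_term q z l) UNIV / qpoch_inf z q"] by simp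
  then show ?thesis
    using sums_unique[of f] \<open>qpoch_inf z q \<noteq> 0\<close> by (simp add: phi11_def f_def[abs_def] field_simps)
qed

text \<open>By Gauss's evaluation only even \<open>N = 2n\<close> contribute.\<close>
lemma even_part_sums_triple_sum:
  "(\<lambda>n. q ^ (2 * n choose 2) * z ^ (2 * n) / qpoch (q\<^sup>2) (q\<^sup>2) n * rr_sum q (2 * n + l))
     sums infsum (triple_term q z l) UNIV"
proof -
  define g where "g N = q ^ (N choose 2) * z ^ N * (\<Sum>j\<le>N. (-1) ^ j / (qpoch q q j * qpoch q q (N - j))) * rr_sum q (N + l)" for N
  have "(\<lambda>M. \<Sum>N<M. g N) \<longlonglongrightarrow> infsum (triple_term q z l) UNIV"
    using has_sum_imp_sums[OF triple_sum_by_m_plus_j] by (simp add: sums_def g_def[abs_def])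
  then have "(\<lambda>M. \<Sum>N<2 * M. g N) \<longlonglongrightarrow> infsum (triple_term q z l) UNIV"
    using LIMSEQ_subseq_LIMSEQ[of "\<lambda>M. \<Sum>N<M. g N" _ "\<lambda>M. 2 * M"] by (simp add: strict_mono_def o_def)
  moreover have "(\<Sum>N<2 * M. g N) = (\<Sum>n<M. g (2 * n))" for M
  proof (induction M)
    case (Suc M)
    have "g (Suc (2 * M)) = 0"
      using alternating_q_binomial_sum_odd[OF q, of M] by (simp only: g_def) simp
    then show ?case
      using Suc by simp
  qed simp
  moreover have "g (2 * n) = q ^ (2 * n choose 2) * z ^ (2 * n) / qpoch (q\<^sup>2) (q\<^sup>2) n * rr_sum q (2 * n + l)" for n
    unfolding g_def alternating_q_binomial_sum_even[OF q] by simp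
  ultimately show ?thesis
    by (simp add: sums_def)
qed

text \<open>The geometric factor alone gives convergence, since \<open>s\<close> and the reciprocals of \<open>(q\<^sup>2;q\<^sup>2)\<^sub>n\<close> are bounded.\<close>
lemma schur_series_summable:
  assumes "Bseq s" "norm w < 1"
  shows "summable (\<lambda>n. s (2 * n + l) / qpoch (q\<^sup>2) (q\<^sup>2) n * w ^ (2 * n))"
proof -
  have q2: "norm (q\<^sup>2) < 1"
    using q power_less_one_iff[of "norm q" 2] by (simp add: norm_power)
  obtain B where "B \<ge> 1 \<and> (\<forall>n. norm (qpoch (q\<^sup>2) (q\<^sup>2) n) \<le> B \<and> norm (1 / qpoch (q\<^sup>2) (q\<^sup>2) n) \<le> B)"
    using qpoch_qq_bounded[OF q2] by (rule exE)
  then have B: "\<And>n. norm (1 / qpoch (q\<^sup>2) (q\<^sup>2) n) \<le> B"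
    by simp
  obtain K where "K > 0" and K: "\<And>n. norm (s n) \<le> K"
    using assms(1) by (meson BseqE)
  have "norm (norm w ^ 2) < 1"
    using assms(2) power_less_one_iff[of "norm w" 2] by simp
  then have "summable (\<lambda>n. K * B * (norm w ^ 2) ^ n)"
    by (intro summable_mult summable_geometric)
  then show ?thesis
  proof (rule summable_comparison_test'[of _ 0])
    fix n
    have "norm (s (2 * n + l)) * norm (1 / qpoch (q\<^sup>2) (q\<^sup>2) n) * norm w ^ (2 * n) \<le> K * B * norm w ^ (2 * n)"
      by (intro mult_right_mono mult_mono K B) (use \<open>K > 0\<close> in auto)
    then show "norm (s (2 * n + l) / qpoch (q\<^sup>2) (q\<^sup>2) n * w ^ (2 * n)) \<le> K * B * (norm w ^ 2) ^ n"
      by (simp add: norm_mult norm_divide norm_power power_mult)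
  qed
qed

end

section \<open>The transformation formula\<close>

text \<open>The triple series connects the left side with the even part of a series of Rogers-Ramanujan sums, which are then
expressed by Schur's polynomials.  The powers of \<open>q\<close> match because
\<open>(2n + l choose 2) = (2n choose 2) + (l choose 2) + 2nl\<close>.  The two separate series converge for small \<open>z\<close>, and then
the limit of the combined partial sums is the difference of their sums.\<close>
theorem theorem2p1:
  fixes q z :: complex and l :: nat
  assumes "0 < norm q" and "norm q < 1"
    and "z \<noteq> 0"
    and "z \<notin> range (\<lambda>k::nat. q powi (- int k))"
  shows "(\<lambda>N.
            (-1) ^ l * q powi (- int (l choose 2)) / (qpoch_inf q (q ^ 5) * qpoch_inf (q ^ 4) (q ^ 5))
              * (\<Sum>n<N. a_term q l z n)
          - (-1) ^ l * q powi (- int (l choose 2)) / (qpoch_inf (q ^ 2) (q ^ 5) * qpoch_inf (q ^ 3) (q ^ 5))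
              * (\<Sum>n<N. b_term q l z n))
         \<longlonglongrightarrow> qpoch_inf z q * phi11 (- (q ^ (l + 1)) / z) z q (- z)
    \<and> (norm z < norm q ^ l \<longrightarrow>
         summable (a_term q l z) \<and> summable (b_term q l z) \<and>
         qpoch_inf z q * phi11 (- (q ^ (l + 1)) / z) z q (- z)
         = (-1) ^ l * q powi (- int (l choose 2)) / (qpoch_inf q (q ^ 5) * qpoch_inf (q ^ 4) (q ^ 5))
              * (\<Sum>n. a_term q l z n)
          - (-1) ^ l * q powi (- int (l choose 2)) / (qpoch_inf (q ^ 2) (q ^ 5) * qpoch_inf (q ^ 3) (q ^ 5))
              * (\<Sum>n. b_term q l z n))"
proof -
  note q = assms(2)
  have q0: "q \<noteq> 0" using assms(1) by auto
  define C where "C = (-1) ^ l * q powi (- int (l choose 2))"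
  define A where "A = qpoch_inf q (q ^ 5) * qpoch_inf (q ^ 4) (q ^ 5)"
  define B where "B = qpoch_inf (q ^ 2) (q ^ 5) * qpoch_inf (q ^ 3) (q ^ 5)"
  define L where "L = qpoch_inf z q * phi11 (- (q ^ (l + 1)) / z) z q (- z)"
  have zq: "z * q ^ k \<noteq> 1" for k
  proof
    assume "z * q ^ k = 1"
    then have "z = q powi (- int k)"
      using q0 by (simp add: power_int_minus field_simps)
    then show False
      using assms(4) by blast
  qed
  have L: "L = infsum (triple_term q z l) UNIV"
    unfolding L_def by (rule phi11_eq_triple_sum[OF q assms(3) zq])
  have "q ^ (2 * n choose 2) * z ^ (2 * n) / qpoch (q\<^sup>2) (q\<^sup>2) n * rr_sum q (2 * n + l)
      = C / A * a_term q l z n - C / B * b_term q l z n" for n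
  proof -
    \<comment> \<open>The signs \<open>(-1)^l\<close> from the prefactor and from the shifted Rogers-Ramanujan sum cancel.\<close>
    let ?d = "qpoch (q\<^sup>2) (q\<^sup>2) n"
    have e: "q ^ ((2 * n + l) choose 2) = q ^ (2 * n choose 2) * q ^ (l choose 2) * (q ^ l) ^ (2 * n)"
      unfolding add_choose_two power_add power_mult[symmetric] by (simp add: mult.commute)
    have C: "C = (-1) ^ l / q ^ (l choose 2)"
      by (simp add: C_def power_int_minus divide_inverse)
    have "C / A * a_term q l z n - C / B * b_term q l z n
        = C / ?d * (z / q ^ l) ^ (2 * n) * (schur_a (2 * n + l) q / A - schur_b (2 * n + l) q / B)"
      unfolding a_term_def b_term_def by (simp add: right_diff_distrib diff_divide_distrib mult_ac)
    also have "schur_a (2 * n + l) q / A - schur_b (2 * n + l) q / B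
        = (-1) ^ (2 * n + l) * q ^ ((2 * n + l) choose 2) * rr_sum q (2 * n + l)"
      unfolding A_def B_def by (rule rr_sum_schur[OF q q0, symmetric])
    also have "\<dots> = (-1) ^ l * (q ^ (2 * n choose 2) * q ^ (l choose 2) * (q ^ l) ^ (2 * n)) * rr_sum q (2 * n + l)"
      unfolding e by (simp add: power_add)
    also have "C / ?d * (z / q ^ l) ^ (2 * n) * \<dots>
        = ((-1) ^ l * (-1) ^ l) * (q ^ (2 * n choose 2) * z ^ (2 * n) / ?d * rr_sum q (2 * n + l))"
      unfolding C power_divide using q0 by simp
    finally show ?thesis
      by (simp add: power_mult_distrib[symmetric])
  qed
  then have main: "(\<lambda>n. C / A * a_term q l z n - C / B * b_term q l z n) sums L"
    using even_part_sums_triple_sum[OF q, of z l] L by simp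
  then have lim: "(\<lambda>N. C / A * (\<Sum>n<N. a_term q l z n) - C / B * (\<Sum>n<N. b_term q l z n)) \<longlonglongrightarrow> L"
    by (simp add: sums_def sum_subtractf sum_distrib_left)
  have "summable (a_term q l z) \<and> summable (b_term q l z)
      \<and> L = C / A * (\<Sum>n. a_term q l z n) - C / B * (\<Sum>n. b_term q l z n)" if "norm z < norm q ^ l"
  proof -
    have w: "norm (z / q ^ l) < 1"
      using that q0 by (simp add: norm_divide norm_power)
    have a: "summable (a_term q l z)"
      unfolding a_term_def[abs_def]
      by (rule schur_series_summable[OF q forward_recursion_bounded[OF q schur_a_rec[OF q]] w])
    have b: "summable (b_term q l z)"
      unfolding b_term_def[abs_def]
      by (rule schur_series_summable[OF q forward_recursion_bounded[OF q schur_b_rec[OF q]] w])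
    have "(\<lambda>n. C / A * a_term q l z n - C / B * b_term q l z n) sums
        (C / A * (\<Sum>n. a_term q l z n) - C / B * (\<Sum>n. b_term q l z n))"
      by (intro sums_diff sums_mult summable_sums a b)
    then show ?thesis
      using a b sums_unique2[OF main] by simp
  qed
  then show ?thesis
    using lim unfolding A_def B_def C_def L_def by simp
qed

end
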